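(* Let $\Phi_1,\Phi_2,\Phi_3$ be Young functions and let $$\alpha=\liminf_{\lambda\to 0^+}\ C_{\Phi_1}(\lambda)\,C_{\Phi_2}(\lambda)\,C_{\Phi_3}\left(\tfrac1\lambda\right)\quad\text{and}\quad \beta=\liminf_{\lambda\to\infty}\ \lambda\, C_{\Phi_1}(\lambda)\,C_{\Phi_2}(\lambda)\,C_{\Phi_3}\left(\tfrac1\lambda\right).$$ If $\alpha=0$ or $\beta=0$, then $\tilde{\mathcal M}_{(\Phi_1,\Phi_2,\Phi_3)}(\mathbb R)=\{0\}$.
   Context: A Young function is a function $\Phi:\mathbb R\to[0,\infty]$, not identically zero, which is convex, even and satisfies $\Phi(0)=0$; it is assumed that $L^\Phi(\mathbb R)\ne\{0\}$, i.e. $\Phi(x)<\infty$ for some $x>0$. The Orlicz space $L^\Phi(\mathbb R)$ consists of the measurable $f:\mathbb R\to\mathbb C$ (modulo a.e. equality) with $\int_{\mathbb R}\Phi(|f(x)|/\lambda)\,dx<\infty$ for some $\lambda>0$, with the Luxemburg norm $N_\Phi(f)=\inf\{\lambda>0:\int_{\mathbb R}\Phi(|f(x)|/\lambda)\,dx\le 1\}$. For $\lambda>0$, $D_\lambda f(x)=f(\lambda x)$ and $C_\Phi(\lambda)=\|D_\lambda\|_{L^\Phi(\mathbb R)\to L^\Phi(\mathbb R)}$ is its operator norm with respect to $N_\Phi$. The Fourier transform is $\hat f(\xi)=\int_{\mathbb R}f(x)e^{-2\pi i x\xi}\,dx$, and $\mathcal P(\mathbb R)$ is the set of $f\in L^1(\mathbb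 R)$ such that $\operatorname{supp}\hat f$ is compact. $\tilde{\mathcal M}_{(\Phi_1,\Phi_2,\Phi_3)}(\mathbb R)$ is the space of locally integrable functions $M:\mathbb R\to\mathbb C$ (modulo a.e. equality) for which there is a constant $C>0$ such that the bilinear map $$B_M(f,g)(x)=\int_{\mathbb R}\int_{\mathbb R}\hat f(\xi)\hat g(\eta)M(\xi-\eta)e^{2\pi i(\xi+\eta)x}\,d\xi\,d\eta$$ satisfies $N_{\Phi_3}(B_M(f,g))\le C\,N_{\Phi_1}(f)N_{\Phi_2}(g)$ for all $f,g\in\mathcal P(\mathbb R)$. *)

theory Defs
  imports "HOL-Analysis.Analysis"
begin

text \<open>
  Elements of the function spaces are represented by functions rather than by classes modulo
  equality almost everywhere; ``measurable'' means Lebesgue measurable.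
\<close>

definition young_function :: "(real \<Rightarrow> ennreal) \<Rightarrow> bool" where
  "young_function \<Phi> \<longleftrightarrow>
     (\<forall>x y t. 0 \<le> t \<and> t \<le> 1 \<longrightarrow>
        \<Phi> ((1 - t) * x + t * y) \<le> ennreal (1 - t) * \<Phi> x + ennreal t * \<Phi> y) \<and>
     (\<forall>x. \<Phi> (- x) = \<Phi> x) \<and>
     \<Phi> 0 = 0 \<and>
     (\<exists>x. \<Phi> x \<noteq> 0) \<and>
     (\<exists>x>0. \<Phi> x < \<infinity>)"

definition orlicz_space :: "(real \<Rightarrow> ennreal) \<Rightarrow> (real \<Rightarrow> complex) set" where
  "orlicz_space \<Phi> = {f \<in> borel_measurable lebesgue.
     \<exists>l>0. (\<integral>\<^sup>+x. \<Phi> (cmod (f x) / l) \<partial>lebesgue) < \<infinity>}"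

text \<open>
  The infimum is taken in \<^typ>\<open>ennreal\<close>. For a Young function it is finite on the Orlicz space and
  \<open>\<infinity>\<close> at every other measurable function.
\<close>

definition luxemburg_norm :: "(real \<Rightarrow> ennreal) \<Rightarrow> (real \<Rightarrow> complex) \<Rightarrow> ennreal" where
  "luxemburg_norm \<Phi> f =
     (INF l\<in>{l. 0 < l \<and> (\<integral>\<^sup>+x. \<Phi> (cmod (f x) / l) \<partial>lebesgue) \<le> 1}. ennreal l)"

definition dilation :: "real \<Rightarrow> (real \<Rightarrow> complex) \<Rightarrow> real \<Rightarrow> complex" where
  "dilation l f = (\<lambda>x. f (l * x))"

definition dilation_norm :: "(real \<Rightarrow> ennreal) \<Rightarrow> real \<Rightarrow> ennreal" where
  "dilation_norm \<Phi> l =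
     (SUP f\<in>{f \<in> orlicz_space \<Phi>. luxemburg_norm \<Phi> f \<le> 1}. luxemburg_norm \<Phi> (dilation l f))"

definition fourier :: "(real \<Rightarrow> complex) \<Rightarrow> real \<Rightarrow> complex" where
  "fourier f \<xi> =
     (\<integral>x. f x * exp (- 2 * complex_of_real pi * \<i> * complex_of_real x * complex_of_real \<xi>) \<partial>lebesgue)"

text \<open>
  The transform of an integrable function is continuous, so its support is the closure of the
  set where it does not vanish.
\<close>

definition compact_spectrum :: "(real \<Rightarrow> complex) set" where
  "compact_spectrum = {f. integrable lebesgue f \<and> compact (closure {\<xi>. fourier f \<xi> \<noteq> 0})}"

definition locally_integrable :: "(real \<Rightarrow> complex) \<Rightarrow> bool" where
  "locally_integrable M \<longleftrightarrow> (\<forall>K. compact K \<longrightarrow> set_integrable lebesgue K M)"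

definition bilinear_multiplier ::
  "(real \<Rightarrow> complex) \<Rightarrow> (real \<Rightarrow> complex) \<Rightarrow> (real \<Rightarrow> complex) \<Rightarrow> real \<Rightarrow> complex" where
  "bilinear_multiplier M f g x =
     (\<integral>\<eta>. (\<integral>\<xi>. fourier f \<xi> * fourier g \<eta> * M (\<xi> - \<eta>) *
        exp (2 * complex_of_real pi * \<i> * complex_of_real (\<xi> + \<eta>) * complex_of_real x) \<partial>lebesgue) \<partial>lebesgue)"

definition multiplier_space ::
  "(real \<Rightarrow> ennreal) \<Rightarrow> (real \<Rightarrow> ennreal) \<Rightarrow> (real \<Rightarrow> ennreal) \<Rightarrow> (real \<Rightarrow> complex) set" where
  "multiplier_space \<Phi>1 \<Phi>2 \<Phi>3 = {M. locally_integrable M \<and>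
     (\<exists>C::real. 0 < C \<and> (\<forall>f\<in>compact_spectrum. \<forall>g\<in>compact_spectrum.
        luxemburg_norm \<Phi>3 (bilinear_multiplier M f g) \<le>
          ennreal C * luxemburg_norm \<Phi>1 f * luxemburg_norm \<Phi>2 g))}"

end

theory Submission
  imports Defs "HOL-Probability.Sinc_Integral"
begin

text \<open>
  Why the theorem holds. Multiplier norms are invariant under translation of \<open>M\<close> and under its
  multiplication by characters, since these operations amount to modulations and translations of the
  two arguments. Dilation of \<open>M\<close> by \<open>l\<close> changes its multiplier norm by at most the factor
  \<open>C\<^sub>1(l) C\<^sub>2(l) C\<^sub>3(1 / l)\<close>, where \<open>C\<^sub>j\<close> denotes the dilation norm of the \<open>j\<close>-th space. These facts
  are put into one inequality about integrals of \<open>M\<close>, lemma \<open>multiplier_test_estimate\<close>: with a fixed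
  continuous nonnegative weight \<open>w\<close> of compact support with \<open>w(0) > 0\<close>,
  \<open>\<bar>\<integral> M(u) exp(2\<pi>it(u - a)) w((u - a) / l) du\<bar> \<le> K l C\<^sub>1(l) C\<^sub>2(l) C\<^sub>3(1 / l)\<close>
  for all real \<open>a\<close>, \<open>t\<close> and all \<open>l > 0\<close>.

  It is obtained by testing the bilinear map on Fejer kernels and pairing the result with a Fejer
  kernel. Their transforms are tents, which are computed from the scaling behaviour of
  \<open>\<integral> (1 - cos(a x)) / x\<^sup>2 dx\<close>, and a Luxemburg norm controls such a pairing, because a Young function
  grows at least linearly.

  If \<open>\<alpha> = 0\<close>, take \<open>t = 0\<close> and divide by \<open>l\<close>: averages of \<open>M\<close> around \<open>a\<close> at scale \<open>l\<close> tend to \<open>0\<close>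
  uniformly in \<open>a\<close> along a sequence \<open>l \<rightarrow> 0\<close>, and integrating over \<open>a\<close> in an interval shows that the
  integral of \<open>M\<close> over it is \<open>0\<close>. If \<open>\<beta> = 0\<close>, the weight becomes constant as \<open>l \<rightarrow> \<infinity>\<close>; in this sense
  the Fourier transform of \<open>M\<close> vanishes, uniformly in the frequency \<open>t\<close>. Integrating over \<open>t\<close> against a
  de la Vallee-Poussin kernel localises \<open>M\<close> to a trapezoid, and again all integrals over intervals
  vanish. In both cases \<open>M = 0\<close> almost everywhere.
\<close>

section \<open>Trapezoids as Fourier transforms\<close>

definition trapezoid :: "real \<Rightarrow> real \<Rightarrow> real \<Rightarrow> real" where
  "trapezoid r R v = max 0 (min 1 ((R - \<bar>v\<bar>) / (R - r)))"

lemma trapezoid_bounds: "0 \<le> trapezoid r R v" "trapezoid r R v \<le> 1"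
  by (auto simp: trapezoid_def)

lemma trapezoid_minus [simp]: "trapezoid r R (- v) = trapezoid r R v"
  by (simp add: trapezoid_def)

lemma trapezoid_inside: "r < R \<Longrightarrow> \<bar>v\<bar> \<le> r \<Longrightarrow> trapezoid r R v = 1"
  by (simp add: trapezoid_def field_simps)

lemma trapezoid_outside: "r < R \<Longrightarrow> R \<le> \<bar>v\<bar> \<Longrightarrow> trapezoid r R v = 0"
  by (simp add: trapezoid_def field_simps max_def min_def)

lemma continuous_on_trapezoid [continuous_intros]:
  "r < R \<Longrightarrow> continuous_on S f \<Longrightarrow> continuous_on S (\<lambda>x. trapezoid r R (f x))"
  unfolding trapezoid_def by (intro continuous_intros) auto

lemma borel_measurable_trapezoid [measurable]: "trapezoid r R \<in> borel_measurable borel"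
  unfolding trapezoid_def by measurable

text \<open>
  The form in which the trapezoid turns up as a Fourier transform: a combination of absolute values,
  each of which is a cosine integral.
\<close>

lemma trapezoid_eq_abs:
  assumes "0 \<le> r" "r < R"
  shows "2 * (R - r) * trapezoid r R v = \<bar>v + R\<bar> + \<bar>v - R\<bar> - \<bar>v + r\<bar> - \<bar>v - r\<bar>"
proof -
  consider "\<bar>v\<bar> \<le> r" | "r < \<bar>v\<bar>" "\<bar>v\<bar> < R" | "R \<le> \<bar>v\<bar>" by linarith
  then show ?thesis
  proof cases
    case 1
    then show ?thesis using assms by (simp add: trapezoid_inside)
  next
    case 2
    then have "trapezoid r R v = (R - \<bar>v\<bar>) / (R - r)"
      using assms by (simp add: trapezoid_def field_simps)
    then have "(R - r) * trapezoid r R v = R - \<bar>v\<bar>"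
      using assms by simp
    then have "2 * (R - r) * trapezoid r R v = 2 * (R - \<bar>v\<bar>)"
      by (simp only: mult.assoc)
    moreover have "2 * (R - \<bar>v\<bar>) = \<bar>v + R\<bar> + \<bar>v - R\<bar> - \<bar>v + r\<bar> - \<bar>v - r\<bar>"
      using 2 assms by (smt (verit))
    ultimately show ?thesis by (rule trans)
  next
    case 3
    then show ?thesis using assms by (simp add: trapezoid_outside)
  qed
qed

lemma one_minus_cos_le: "1 - cos x \<le> x\<^sup>2 / 2" for x :: real
proof -
  have "(sin (x / 2))\<^sup>2 \<le> (x / 2)\<^sup>2"
    using abs_sin_x_le_abs_x[of "x / 2"] by (subst abs_le_square_iff[symmetric])
  moreover have "1 - cos x = 2 * (sin (x / 2))\<^sup>2"
    using cos_double_sin[of "x / 2"] by simp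
  ultimately show ?thesis by (simp add: power_divide)
qed

lemma one_minus_cos_quotient_bounds:
  fixes x :: real
  shows "0 \<le> (1 - cos x) / x\<^sup>2" "(1 - cos x) / x\<^sup>2 \<le> 1 / 2"
    and "(1 - cos x) / x\<^sup>2 \<le> 4 * inverse (1 + x\<^sup>2)"
proof -
  show 0: "0 \<le> (1 - cos x) / x\<^sup>2" by (simp add: cos_le_one)
  show 1: "(1 - cos x) / x\<^sup>2 \<le> 1 / 2"
    using one_minus_cos_le[of x] by (cases "x = 0") (auto simp: field_simps)
  show "(1 - cos x) / x\<^sup>2 \<le> 4 * inverse (1 + x\<^sup>2)"
  proof (cases "x\<^sup>2 \<le> 1")
    case True
    then have "1 / 2 \<le> 4 * inverse (1 + x\<^sup>2)"
      by (simp add: field_simps add_pos_nonneg)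
    with 1 show ?thesis by linarith
  next
    case False
    have "(1 - cos x) / x\<^sup>2 \<le> 2 / x\<^sup>2"
      using cos_ge_minus_one[of x] by (intro divide_right_mono) auto
    also have "\<dots> \<le> 4 * inverse (1 + x\<^sup>2)"
    proof -
      have "2 * (1 + x\<^sup>2) \<le> 4 * x\<^sup>2" using False by simp
      moreover have "0 < x\<^sup>2" using False by linarith
      moreover have "0 < 1 + x\<^sup>2" using False by linarith
      ultimately show ?thesis by (simp add: divide_simps)
    qed
    finally show ?thesis .
  qed
qed

lemma integrable_one_minus_cos: "integrable lborel (\<lambda>x::real. (1 - cos x) / x\<^sup>2)"
proof (rule Bochner_Integration.integrable_bound)
  show "integrable lborel (\<lambda>x::real. 4 * inverse (1 + x\<^sup>2))"
    using integrable_inverse_1_plus_square by (simp add: set_integrable_def)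
  show "AE x in lborel. norm ((1 - cos x) / x\<^sup>2) \<le> norm (4 * inverse (1 + x\<^sup>2) :: real)"
    using one_minus_cos_quotient_bounds by (intro AE_I2) (smt (verit) real_norm_def)
qed measurable

text \<open>
  This constant is \<open>\<pi>\<close>. Normalising by it spares the evaluation of the integral:
  a positive finite number is all that a normalisation asks for.
\<close>

definition cos_mass :: real where
  "cos_mass = (\<integral>x. (1 - cos x) / x\<^sup>2 \<partial>lborel)"

text \<open>
  The integrand is nonnegative and vanishes in the open interval \<open>(0, 2\<pi>)\<close> nowhere.
\<close>

lemma cos_mass_pos: "0 < cos_mass"
proof -
  let ?J = "\<lambda>x::real. (1 - cos x) / x\<^sup>2"
  have "0 \<le> cos_mass"
    unfolding cos_mass_def by (intro Bochner_Integration.integral_nonneg) (use one_minus_cos_quotient_bounds in auto)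
  moreover have "cos_mass \<noteq> 0"
  proof
    assume "cos_mass = 0"
    then have "AE x in lborel. ?J x = 0"
      unfolding cos_mass_def
      using integral_nonneg_eq_0_iff_AE[OF integrable_one_minus_cos] one_minus_cos_quotient_bounds
      by auto
    then have "AE x in lborel. x \<notin> {0<..<2*pi::real}"
    proof (rule AE_mp, intro AE_I2 impI)
      fix x :: real assume "?J x = 0"
      show "x \<notin> {0<..<2*pi}"
      proof
        assume x: "x \<in> {0<..<2*pi}"
        then have "cos x = 1" using \<open>?J x = 0\<close> by auto
        then obtain n::int where "x = n * 2 * pi" using cos_one_2pi_int by auto
        with x have "0 < real_of_int n" "real_of_int n < 1" by (auto simp: zero_less_mult_iff)
        then have "0 < n" "n < 1" by simp_all
        then show False by linarith
      qed
    qed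
    then have "emeasure lborel {0<..<2*pi::real} = 0"
      by (subst (asm) AE_iff_measurable[OF _ refl]) (auto simp: greaterThanLessThan_def greaterThan_def lessThan_def Int_def)
    then show False by simp
  qed
  ultimately show ?thesis by linarith
qed

text \<open>
  Scaling alone produces the absolute value: substituting \<open>a x\<close> in the unscaled integral costs \<open>\<bar>a\<bar>\<close>
  from the measure and gains \<open>a\<^sup>2\<close> from the denominator.
\<close>

lemma has_integral_one_minus_cos_scaled:
  "has_bochner_integral lborel (\<lambda>x::real. (1 - cos (a * x)) / x\<^sup>2) (cos_mass * \<bar>a\<bar>)"
proof (cases "a = 0")
  case True
  then show ?thesis by (simp add: has_bochner_integral_zero)
next
  case False
  let ?J = "\<lambda>x::real. (1 - cos x) / x\<^sup>2"
  have eq: "(1 - cos (a * x)) / x\<^sup>2 = a\<^sup>2 * ?J (0 + a * x)" for x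
    using False by (simp add: power_mult_distrib)
  have "has_bochner_integral lborel ?J cos_mass"
    unfolding cos_mass_def using integrable_one_minus_cos by (rule has_bochner_integral_integrable)
  then have "has_bochner_integral lborel (\<lambda>x. ?J (0 + a * x)) (cos_mass /\<^sub>R \<bar>a\<bar>)"
    using False by (subst (asm) lborel_has_bochner_integral_real_affine_iff[where c=a and t=0]) auto
  then have "has_bochner_integral lborel (\<lambda>x. a\<^sup>2 * ?J (0 + a * x)) (a\<^sup>2 * (cos_mass /\<^sub>R \<bar>a\<bar>))"
    by (intro has_bochner_integral_mult_right)
  moreover have "a\<^sup>2 * (cos_mass /\<^sub>R \<bar>a\<bar>) = cos_mass * \<bar>a\<bar>"
    using False by (simp add: field_simps power2_eq_square abs_if)
  ultimately show ?thesis unfolding eq by metis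
qed

text \<open>
  The de la Vallee-Poussin kernel, and for \<open>r = 0\<close> the Fejer kernel, normalised such that its
  Fourier transform is a trapezoid of height one. The value at \<open>0\<close> is \<open>0\<close> by the convention
  for division, which affects a null set only.
\<close>

definition vallee_poussin :: "real \<Rightarrow> real \<Rightarrow> real \<Rightarrow> real" where
  "vallee_poussin r R x =
     (cos (2 * pi * r * x) - cos (2 * pi * R * x)) / x\<^sup>2 / (2 * pi * cos_mass * (R - r))"

lemma borel_measurable_vallee_poussin [measurable]: "vallee_poussin r R \<in> borel_measurable borel"
  unfolding vallee_poussin_def by measurable

lemma vallee_poussin_minus [simp]: "vallee_poussin r R (- x) = vallee_poussin r R x"
  by (simp add: vallee_poussin_def)

text \<open>
  The product formula for cosines splits the integrand into four terms \<open>(1 - cos (a x)) / x\<^sup>2\<close>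
  whose integrals are multiples of \<open>\<bar>a\<bar>\<close>. Thus an explicit kernel with an explicit compactly supported
  transform is found without Fourier inversion.
\<close>

lemma has_integral_vallee_poussin_cos:
  assumes "0 \<le> r" "r < R"
  shows "has_bochner_integral lborel (\<lambda>x. vallee_poussin r R x * cos (2 * pi * \<xi> * x)) (trapezoid r R \<xi>)"
proof -
  let ?Q = "\<lambda>a x::real. (1 - cos (2 * pi * a * x)) / x\<^sup>2"
  let ?n = "2 * (2 * pi * cos_mass * (R - r))"
  have Q: "has_bochner_integral lborel (?Q a) (cos_mass * (2 * pi * \<bar>a\<bar>))" for a
    using has_integral_one_minus_cos_scaled[of "2 * pi * a"] by (simp add: abs_mult)
  have eq: "vallee_poussin r R x * cos (2 * pi * \<xi> * x) =
      (?Q (\<xi> + R) x + ?Q (\<xi> - R) x - ?Q (\<xi> + r) x - ?Q (\<xi> - r) x) / ?n" for x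
  proof -
    have *: "cos (2 * pi * (\<xi> + a) * x) + cos (2 * pi * (\<xi> - a) * x)
        = 2 * (cos (2 * pi * a * x) * cos (2 * pi * \<xi> * x))" for a
      by (simp add: algebra_simps cos_add cos_diff)
    have "?Q (\<xi> + R) x + ?Q (\<xi> - R) x - ?Q (\<xi> + r) x - ?Q (\<xi> - r) x
        = ((cos (2 * pi * (\<xi> + r) * x) + cos (2 * pi * (\<xi> - r) * x))
          - (cos (2 * pi * (\<xi> + R) * x) + cos (2 * pi * (\<xi> - R) * x))) / x\<^sup>2"
      by (simp add: diff_divide_distrib add_divide_distrib)
    also have "\<dots> = 2 * ((cos (2 * pi * r * x) - cos (2 * pi * R * x)) / x\<^sup>2 * cos (2 * pi * \<xi> * x))"
      unfolding * by (simp add: diff_divide_distrib algebra_simps)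
    finally have *: "?Q (\<xi> + R) x + ?Q (\<xi> - R) x - ?Q (\<xi> + r) x - ?Q (\<xi> - r) x
      = 2 * ((cos (2 * pi * r * x) - cos (2 * pi * R * x)) / x\<^sup>2 * cos (2 * pi * \<xi> * x))" .
    have "y / n * c = 2 * (y * c) / (2 * n)" for y c n :: real
      by simp
    then show ?thesis
      unfolding vallee_poussin_def * by blast
  qed
  have "has_bochner_integral lborel
      (\<lambda>x. (?Q (\<xi> + R) x + ?Q (\<xi> - R) x - ?Q (\<xi> + r) x - ?Q (\<xi> - r) x) / ?n)
      ((cos_mass * (2 * pi * \<bar>\<xi> + R\<bar>) + cos_mass * (2 * pi * \<bar>\<xi> - R\<bar>)
        - cos_mass * (2 * pi * \<bar>\<xi> + r\<bar>) - cos_mass * (2 * pi * \<bar>\<xi> - r\<bar>)) / ?n)"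
    by (intro has_bochner_integral_divide has_bochner_integral_add has_bochner_integral_diff Q)
  moreover have "(cos_mass * (2 * pi * \<bar>\<xi> + R\<bar>) + cos_mass * (2 * pi * \<bar>\<xi> - R\<bar>)
        - cos_mass * (2 * pi * \<bar>\<xi> + r\<bar>) - cos_mass * (2 * pi * \<bar>\<xi> - r\<bar>)) / ?n = trapezoid r R \<xi>"
  proof -
    have "cos_mass * (2 * pi * \<bar>\<xi> + R\<bar>) + cos_mass * (2 * pi * \<bar>\<xi> - R\<bar>)
        - cos_mass * (2 * pi * \<bar>\<xi> + r\<bar>) - cos_mass * (2 * pi * \<bar>\<xi> - r\<bar>)
        = 2 * pi * cos_mass * (2 * (R - r) * trapezoid r R \<xi>)"
      unfolding trapezoid_eq_abs[OF assms] by (simp add: algebra_simps)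
    also have "\<dots> = ?n * trapezoid r R \<xi>" by simp
    finally show ?thesis
      using cos_mass_pos assms by simp
  qed
  ultimately show ?thesis unfolding eq by simp
qed

lemma integrable_vallee_poussin:
  assumes "0 \<le> r" "r < R"
  shows "integrable lborel (vallee_poussin r R)"
  using has_integral_vallee_poussin_cos[OF assms, of 0]
  by (auto dest: integrable.intros)

lemma bounded_vallee_poussin: "\<exists>B>0. \<forall>x. \<bar>vallee_poussin r R x\<bar> \<le> B"
proof -
  let ?J = "\<lambda>x::real. (1 - cos x) / x\<^sup>2"
  let ?n = "\<bar>2 * pi * cos_mass * (R - r)\<bar>"
  have J: "\<bar>(1 - cos (a * x)) / x\<^sup>2\<bar> \<le> a\<^sup>2" for a x :: real
  proof -
    have "\<bar>1 - cos (a * x)\<bar> \<le> (a * x)\<^sup>2 / 2"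
      using one_minus_cos_le[of "a * x"] by simp
    also have "\<dots> \<le> a\<^sup>2 * x\<^sup>2" by (simp add: power_mult_distrib)
    finally show ?thesis by (cases "x = 0") (auto simp: field_simps)
  qed
  have "\<bar>vallee_poussin r R x\<bar> \<le> ((2 * pi * r)\<^sup>2 + (2 * pi * R)\<^sup>2) / ?n + 1" for x
  proof -
    have "\<bar>(cos (2 * pi * r * x) - cos (2 * pi * R * x)) / x\<^sup>2\<bar> \<le> (2 * pi * r)\<^sup>2 + (2 * pi * R)\<^sup>2"
      using J[of "2 * pi * r" x] J[of "2 * pi * R" x] by (simp add: diff_divide_distrib)
    then have "\<bar>vallee_poussin r R x\<bar> \<le> ((2 * pi * r)\<^sup>2 + (2 * pi * R)\<^sup>2) / ?n"
      unfolding vallee_poussin_def by (simp only: abs_divide) (intro divide_right_mono, auto)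
    then show ?thesis by linarith
  qed
  moreover have "0 < ((2 * pi * r)\<^sup>2 + (2 * pi * R)\<^sup>2) / ?n + 1"
    by (intro add_nonneg_pos divide_nonneg_nonneg) auto
  ultimately show ?thesis by blast
qed

lemma integral_vallee_poussin_exp:
  assumes "0 \<le> r" "r < R"
  shows "(\<integral>x. complex_of_real (vallee_poussin r R x) * cis (2 * pi * \<xi> * x) \<partial>lborel)
    = complex_of_real (trapezoid r R \<xi>)"
proof -
  let ?v = "vallee_poussin r R"
  let ?I = "\<integral>x. ?v x * sin (2 * pi * \<xi> * x) \<partial>lborel"
  have ic: "integrable lborel (\<lambda>x. ?v x * cos (2 * pi * \<xi> * x))"
    using has_integral_vallee_poussin_cos[OF assms] by (rule integrable.intros)
  have int_sin: "integrable lborel (\<lambda>x. ?v x * sin (2 * pi * \<xi> * x))"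
    by (rule Bochner_Integration.integrable_bound[OF integrable_vallee_poussin[OF assms]])
       (auto simp: abs_mult intro!: mult_left_le)
  \<comment> \<open>The kernel is even, so the sine part of the transform vanishes.\<close>
  have "?I = (\<integral>x. ?v (- x) * sin (2 * pi * \<xi> * (- x)) \<partial>lborel)"
    using lborel_integral_real_affine[of "-1" "\<lambda>x. ?v x * sin (2 * pi * \<xi> * x)" 0] by simp
  then have "?I = 0" by simp
  have "(\<integral>x. complex_of_real (?v x) * cis (2 * pi * \<xi> * x) \<partial>lborel) =
      (\<integral>x. complex_of_real (?v x * cos (2 * pi * \<xi> * x))
        + \<i> * complex_of_real (?v x * sin (2 * pi * \<xi> * x)) \<partial>lborel)"
    by (intro Bochner_Integration.integral_cong) (auto simp: complex_eq_iff)
  also have "\<dots> = complex_of_real (\<integral>x. ?v x * cos (2 * pi * \<xi> * x) \<partial>lborel) + \<i> * complex_of_real ?I"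
    using ic int_sin by (subst Bochner_Integration.integral_add) (auto simp del: of_real_mult intro!: integrable_mult_right)
  also have "\<dots> = complex_of_real (trapezoid r R \<xi>)"
    using has_integral_vallee_poussin_cos[OF assms, of \<xi>] \<open>?I = 0\<close>
    by (simp add: has_bochner_integral_integral_eq)
  finally show ?thesis .
qed

section \<open>Luxemburg norms and dilations\<close>

lemma young_function_scale:
  assumes "young_function \<Phi>" "0 \<le> t" "t \<le> 1"
  shows "\<Phi> (t * x) \<le> ennreal t * \<Phi> x"
proof -
  have "\<Phi> ((1 - t) * 0 + t * x) \<le> ennreal (1 - t) * \<Phi> 0 + ennreal t * \<Phi> x"
    using assms unfolding young_function_def by blast
  then show ?thesis using assms by (simp add: young_function_def)
qed

lemma young_function_mono:
  assumes "young_function \<Phi>" "0 \<le> x" "x \<le> y"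
  shows "\<Phi> x \<le> \<Phi> y"
proof (cases "y = 0")
  case False
  have "\<Phi> ((x / y) * y) \<le> ennreal (x / y) * \<Phi> y"
    using assms False by (intro young_function_scale) auto
  also have "\<dots> \<le> 1 * \<Phi> y"
    using assms False by (intro mult_right_mono) auto
  finally show ?thesis using False by simp
qed (use assms in auto)

text \<open>
  Sublevel sets are intervals, because the function is even and increases on the half-line.
\<close>

lemma young_function_borel:
  assumes "young_function \<Phi>"
  shows "\<Phi> \<in> borel_measurable borel"
proof -
  have abs: "\<Phi> x = \<Phi> \<bar>x\<bar>" for x
    using assms by (auto simp: young_function_def abs_if)
  have "{x. \<Phi> x \<le> a} \<in> sets borel" for a
  proof -
    have "is_interval {x. \<Phi> x \<le> a}"
    proof -
      have "\<Phi> x \<le> a" if "\<Phi> p \<le> a" "\<Phi> q \<le> a" "p \<le> x" "x \<le> q" for p q x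
      proof (cases "\<bar>x\<bar> \<le> \<bar>p\<bar>")
        case True
        then show ?thesis
          using young_function_mono[OF assms, of "\<bar>x\<bar>" "\<bar>p\<bar>"] that abs[of x] abs[of p] by simp
      next
        case False
        then have "\<bar>x\<bar> \<le> \<bar>q\<bar>" using that by linarith
        then show ?thesis
          using young_function_mono[OF assms, of "\<bar>x\<bar>" "\<bar>q\<bar>"] that abs[of x] abs[of q] by simp
      qed
      then show ?thesis unfolding is_interval_1 by blast
    qed
    then show ?thesis by (rule real_interval_borel_measurable)
  qed
  then show ?thesis by (intro borel_measurableI_le) auto
qed

text \<open>
  Convexity forces at least linear growth beyond any point where the function is positive. The
  summand \<open>x\<^sub>0\<close> accounts for arguments up to that point.
\<close>

lemma young_function_linear_bound:
  assumes "young_function \<Phi>"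
  obtains c x\<^sub>0 :: real where "0 < c" "0 < x\<^sub>0" "\<And>t. 0 \<le> t \<Longrightarrow> ennreal t \<le> ennreal c * \<Phi> t + ennreal x\<^sub>0"
proof -
  obtain x where x: "\<Phi> x \<noteq> 0" using assms unfolding young_function_def by blast
  define x\<^sub>0 where "x\<^sub>0 = \<bar>x\<bar>"
  have x0: "\<Phi> x\<^sub>0 \<noteq> 0" "0 < x\<^sub>0"
  proof -
    have "\<Phi> 0 = 0" "\<Phi> (- x) = \<Phi> x" using assms by (auto simp: young_function_def)
    then have "\<Phi> x\<^sub>0 \<noteq> 0" "x \<noteq> 0" using x by (auto simp: x\<^sub>0_def abs_if)
    then show "\<Phi> x\<^sub>0 \<noteq> 0" "0 < x\<^sub>0" by (auto simp: x\<^sub>0_def)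
  qed
  \<comment> \<open>The function may be infinite at \<open>x\<^sub>0\<close>, so a finite positive minorant of the value is used.\<close>
  obtain m where m: "0 < m" "ennreal m \<le> \<Phi> x\<^sub>0"
  proof (cases "\<Phi> x\<^sub>0")
    case (real r)
    then show ?thesis using x0(1) that[of r] by auto
  next
    case top
    then show ?thesis using that[of 1] by auto
  qed
  have "ennreal t \<le> ennreal (x\<^sub>0 / m) * \<Phi> t + ennreal x\<^sub>0" if "0 \<le> t" for t
  proof (cases "t \<le> x\<^sub>0")
    case True
    then have "ennreal t \<le> 0 + ennreal x\<^sub>0" by (simp add: ennreal_leI)
    also have "\<dots> \<le> ennreal (x\<^sub>0 / m) * \<Phi> t + ennreal x\<^sub>0" by (intro add_right_mono) auto
    finally show ?thesis .
  next
    case False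
    have "ennreal m \<le> \<Phi> ((x\<^sub>0 / t) * t)" using m False x0 by simp
    also have "\<dots> \<le> ennreal (x\<^sub>0 / t) * \<Phi> t"
      using False x0 by (intro young_function_scale assms) auto
    finally have *: "ennreal m \<le> ennreal (x\<^sub>0 / t) * \<Phi> t" .
    have "ennreal t = ennreal (t / m) * ennreal m"
      using m that by (simp flip: ennreal_mult)
    also have "\<dots> \<le> ennreal (t / m) * (ennreal (x\<^sub>0 / t) * \<Phi> t)"
      using * by (intro mult_left_mono) auto
    also have "\<dots> = ennreal (x\<^sub>0 / m) * \<Phi> t"
      using False m x0 by (simp add: mult.assoc[symmetric] flip: ennreal_mult)
    also have "\<dots> \<le> ennreal (x\<^sub>0 / m) * \<Phi> t + ennreal x\<^sub>0" by simp
    finally show ?thesis .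
  qed
  then show ?thesis using that[of "x\<^sub>0 / m" x\<^sub>0] m x0 by simp
qed

lemma luxemburg_norm_cong:
  "(\<And>x. cmod (f x) = cmod (g x)) \<Longrightarrow> luxemburg_norm \<Phi> f = luxemburg_norm \<Phi> g"
  by (simp add: luxemburg_norm_def)

text \<open>
  A strict inequality, so that it does not matter whether the infimum in the norm is attained.
\<close>

lemma luxemburg_norm_lessD:
  assumes \<Phi>: "young_function \<Phi>" and "luxemburg_norm \<Phi> f < ennreal r"
  shows "(\<integral>\<^sup>+x. \<Phi> (cmod (f x) / r) \<partial>lebesgue) \<le> 1"
proof -
  obtain l where l: "0 < l" "(\<integral>\<^sup>+x. \<Phi> (cmod (f x) / l) \<partial>lebesgue) \<le> 1" "ennreal l < ennreal r"
    using assms(2) unfolding luxemburg_norm_def INF_less_iff by blast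
  then have "l < r" by (metis ennreal_less_iff less_le_not_le linorder_not_less ennreal_leI)
  have "(\<integral>\<^sup>+x. \<Phi> (cmod (f x) / r) \<partial>lebesgue) \<le> (\<integral>\<^sup>+x. \<Phi> (cmod (f x) / l) \<partial>lebesgue)"
    using l \<open>l < r\<close> by (intro nn_integral_mono young_function_mono[OF \<Phi>] divide_left_mono) auto
  with l show ?thesis by simp
qed

lemma luxemburg_norm_leI:
  assumes "0 < l" "(\<integral>\<^sup>+x. \<Phi> (cmod (f x) / l) \<partial>lebesgue) \<le> 1"
  shows "luxemburg_norm \<Phi> f \<le> ennreal l"
  unfolding luxemburg_norm_def using assms by (intro INF_lower) auto

text \<open>
  Near \<open>0\<close> a Young function lies below a linear one, so a bounded integrable function has finite
  modular as soon as it is divided by a number that is large compared to its bound.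
\<close>

lemma luxemburg_norm_finite:
  assumes \<Phi>: "young_function \<Phi>" and f: "integrable lebesgue f" and B: "\<And>x. cmod (f x) \<le> B"
  shows "luxemburg_norm \<Phi> f < \<infinity>"
proof -
  obtain y where y: "0 < y" "\<Phi> y < \<infinity>" using \<Phi> unfolding young_function_def by blast
  obtain p where p: "0 \<le> p" "\<Phi> y = ennreal p" using y(2) by (cases "\<Phi> y") auto
  define I where "I = (\<integral>x. cmod (f x) \<partial>lebesgue)"
  have I: "0 \<le> I" "(\<integral>\<^sup>+x. ennreal (cmod (f x)) \<partial>lebesgue) = ennreal I"
    using f by (auto simp: I_def nn_integral_eq_integral)
  define l where "l = max 1 (max (B / y) (p * I / y))"
  have l: "0 < l" "B / y \<le> l" "p * I / y \<le> l" by (auto simp: l_def)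
  have "\<Phi> (cmod (f x) / l) \<le> ennreal (p / (l * y)) * ennreal (cmod (f x))" for x
  proof -
    have le: "cmod (f x) / (l * y) \<le> 1"
      using B[of x] l y by (simp add: field_simps)
    have "\<Phi> (cmod (f x) / l) = \<Phi> (cmod (f x) / (l * y) * y)"
      using y by simp
    also have "\<dots> \<le> ennreal (cmod (f x) / (l * y)) * \<Phi> y"
      using l y le by (intro young_function_scale \<Phi>) auto
    also have "\<dots> = ennreal (p / (l * y)) * ennreal (cmod (f x))"
      using p l y by (simp add: mult_ac flip: ennreal_mult)
    finally show ?thesis .
  qed
  then have "(\<integral>\<^sup>+x. \<Phi> (cmod (f x) / l) \<partial>lebesgue) \<le> (\<integral>\<^sup>+x. ennreal (p / (l * y)) * ennreal (cmod (f x)) \<partial>lebesgue)"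
    by (intro nn_integral_mono)
  also have "\<dots> = ennreal (p / (l * y)) * ennreal I"
    using f I by (subst nn_integral_cmult) (auto dest: borel_measurable_integrable)
  also have "\<dots> = ennreal (p * I / y / l)"
    using p l y I by (simp add: mult_ac flip: ennreal_mult)
  also have "\<dots> \<le> 1"
    using l by (metis divide_le_eq_1_pos ennreal_le_1)
  finally have "luxemburg_norm \<Phi> f \<le> ennreal l"
    using l by (intro luxemburg_norm_leI)
  then show ?thesis by (simp add: order_le_less_trans)
qed

lemma nn_integral_dilation:
  fixes f :: "real \<Rightarrow> complex"
  assumes \<Phi>: "young_function \<Phi>" and f: "f \<in> borel_measurable lebesgue" and "0 < l" 
  shows "(\<integral>\<^sup>+x. \<Phi> (cmod (f (s + l * x)) / r) \<partial>lebesgue) = ennreal (1 / l) * (\<integral>\<^sup>+x. \<Phi> (cmod (f x) / r) \<partial>lebesgue)"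
proof -
  note [measurable] = young_function_borel[OF \<Phi>] f
  have "(\<integral>\<^sup>+x. \<Phi> (cmod (f x) / r) \<partial>lebesgue) = ennreal l * (\<integral>\<^sup>+x. \<Phi> (cmod (f (s + l * x)) / r) \<partial>lebesgue)"
    using \<open>0 < l\<close> by (subst nn_integral_real_affine_lebesgue[where t=s and c=l]) auto
  then show ?thesis
    using \<open>0 < l\<close> by (simp add: mult.assoc[symmetric] flip: ennreal_mult)
qed

lemma luxemburg_norm_translate:
  assumes "young_function \<Phi>" and "f \<in> borel_measurable lebesgue"
  shows "luxemburg_norm \<Phi> (\<lambda>x. f (s + x)) = luxemburg_norm \<Phi> f"
proof -
  have "(\<integral>\<^sup>+x. \<Phi> (cmod (f (s + x)) / r) \<partial>lebesgue) = (\<integral>\<^sup>+x. \<Phi> (cmod (f x) / r) \<partial>lebesgue)" for r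
    using nn_integral_dilation[OF assms, of 1 s r] by simp
  then show ?thesis unfolding luxemburg_norm_def by (simp only:)
qed

text \<open>
  A dilation by \<open>l\<close> multiplies integrals by \<open>1 / l\<close>, and convexity lets a factor \<open>1 / K\<close> be moved inside
  the Young function. Finiteness is what makes products with a vanishing norm unambiguous below.
\<close>

lemma dilation_norm_finite:
  assumes \<Phi>: "young_function \<Phi>" and "0 < l"
  shows "dilation_norm \<Phi> l < \<infinity>"
proof -
  define K where "K = max 1 (1 / l)"
  have K: "1 \<le> K" "1 / l \<le> K" by (auto simp: K_def)
  have "luxemburg_norm \<Phi> (dilation l f) \<le> ennreal (2 * K)"
    if f: "f \<in> orlicz_space \<Phi>" and le: "luxemburg_norm \<Phi> f \<le> 1" for f
  proof (rule luxemburg_norm_leI)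
    have meas[measurable]: "f \<in> borel_measurable lebesgue" using f by (simp add: orlicz_space_def)
    note [measurable] = young_function_borel[OF \<Phi>]
    \<comment> \<open>The norm may equal \<open>1\<close> without the infimum being attained, hence the factor \<open>2\<close>.\<close>
    have "luxemburg_norm \<Phi> f < ennreal 2" using le by (rule order_le_less_trans) auto
    then have 2: "(\<integral>\<^sup>+x. \<Phi> (cmod (f x) / 2) \<partial>lebesgue) \<le> 1" by (rule luxemburg_norm_lessD[OF \<Phi>])
    have "(\<integral>\<^sup>+x. \<Phi> (cmod (dilation l f x) / (2 * K)) \<partial>lebesgue)
        = ennreal (1 / l) * (\<integral>\<^sup>+x. \<Phi> (cmod (f x) / (2 * K)) \<partial>lebesgue)"
      using nn_integral_dilation[OF \<Phi> meas \<open>0 < l\<close>, of 0] by (simp add: dilation_def)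
    also have "(\<integral>\<^sup>+x. \<Phi> (cmod (f x) / (2 * K)) \<partial>lebesgue) \<le> (\<integral>\<^sup>+x. ennreal (1 / K) * \<Phi> (cmod (f x) / 2) \<partial>lebesgue)"
    proof (rule nn_integral_mono)
      fix x
      show "\<Phi> (cmod (f x) / (2 * K)) \<le> ennreal (1 / K) * \<Phi> (cmod (f x) / 2)"
        using young_function_scale[OF \<Phi>, of "1 / K" "cmod (f x) / 2"] K by (simp add: mult.commute)
    qed
    also have "\<dots> = ennreal (1 / K) * (\<integral>\<^sup>+x. \<Phi> (cmod (f x) / 2) \<partial>lebesgue)"
      by (rule nn_integral_cmult) measurable
    also have "\<dots> \<le> ennreal (1 / K) * 1" using 2 by (intro mult_left_mono) auto
    also have "ennreal (1 / l) * (ennreal (1 / K) * 1) = ennreal (1 / l / K)"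
      using \<open>0 < l\<close> K by (simp flip: ennreal_mult)
    also have "\<dots> \<le> 1" using K by (metis divide_le_eq_1_pos ennreal_le_1 order_less_le_trans zero_less_one)
    finally show "(\<integral>\<^sup>+x. \<Phi> (cmod (dilation l f x) / (2 * K)) \<partial>lebesgue) \<le> 1"
      by (auto simp: mult_left_mono)
  qed (use K in auto)
  then have "dilation_norm \<Phi> l \<le> ennreal (2 * K)"
    unfolding dilation_norm_def by (intro SUP_least) auto
  then show ?thesis by (simp add: order_le_less_trans)
qed



text \<open>
  The defining supremum ranges over the unit ball, so the function has to be normalised. Its norm
  may vanish; the function is therefore divided by numbers slightly larger than the norm, which then
  tend to it.
\<close>

lemma luxemburg_norm_dilation_le:
  assumes \<Phi>: "young_function \<Phi>" and l: "0 < l" and f: "f \<in> borel_measurable lebesgue"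
    and fin: "luxemburg_norm \<Phi> f < \<infinity>"
  shows "luxemburg_norm \<Phi> (dilation l f) \<le> dilation_norm \<Phi> l * luxemburg_norm \<Phi> f"
proof -
  define C where "C = enn2real (dilation_norm \<Phi> l)"
  define N where "N = enn2real (luxemburg_norm \<Phi> f)"
  have C: "0 \<le> C" "dilation_norm \<Phi> l = ennreal C"
    using dilation_norm_finite[OF \<Phi> l] by (auto simp: C_def)
  have N: "0 \<le> N" "luxemburg_norm \<Phi> f = ennreal N"
    using fin by (auto simp: N_def)
  have step: "luxemburg_norm \<Phi> (dilation l f) \<le> ennreal (C' * r)" if r: "N < r" and C': "C < C'" for r C'
  proof -
    have r0: "0 < r" and C'0: "0 < C'" using r N C' C by auto
    have "luxemburg_norm \<Phi> f < ennreal r" using N r by (simp add: ennreal_lessI r0)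
    then have 1: "(\<integral>\<^sup>+x. \<Phi> (cmod (f x) / r) \<partial>lebesgue) \<le> 1" by (rule luxemburg_norm_lessD[OF \<Phi>])
    let ?g = "\<lambda>x. f x / of_real r"
    have g: "cmod (?g x) = cmod (f x) / r" for x using r0 by (simp add: norm_divide)
    have "luxemburg_norm \<Phi> ?g \<le> ennreal 1"
      using 1 by (intro luxemburg_norm_leI) (auto simp: g)
    moreover have "?g \<in> orlicz_space \<Phi>"
      using f 1 by (auto simp: orlicz_space_def g intro!: exI[of _ 1] order_le_less_trans[OF 1])
    ultimately have "luxemburg_norm \<Phi> (dilation l ?g) \<le> ennreal C"
      unfolding C(2)[symmetric] dilation_norm_def by (intro SUP_upper) auto
    also have "\<dots> < ennreal C'" using C C' by (simp add: ennreal_lessI C'0)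
    finally have "(\<integral>\<^sup>+x. \<Phi> (cmod (dilation l ?g x) / C') \<partial>lebesgue) \<le> 1"
      by (rule luxemburg_norm_lessD[OF \<Phi>])
    moreover have "cmod (dilation l ?g x) / C' = cmod (dilation l f x) / (C' * r)" for x
      using r0 by (simp add: dilation_def norm_divide mult.commute)
    ultimately show ?thesis
      using C'0 r0 by (intro luxemburg_norm_leI) auto
  qed
  have "luxemburg_norm \<Phi> (dilation l f) \<le> ennreal (C * N)"
  proof (rule tendsto_le[OF trivial_limit_sequentially _ tendsto_const])
    show "(\<lambda>n. ennreal ((C + 1 / real (Suc n)) * (N + 1 / real (Suc n)))) \<longlonglongrightarrow> ennreal (C * N)"
      by (rule tendsto_eq_intros LIMSEQ_Suc[OF lim_1_over_n] refl | simp)+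
    show "\<forall>\<^sub>F n in sequentially. luxemburg_norm \<Phi> (dilation l f) \<le> ennreal ((C + 1 / real (Suc n)) * (N + 1 / real (Suc n)))"
      by (intro always_eventually allI step) auto
  qed
  then show ?thesis by (simp add: C(2) N(2) ennreal_mult C(1) N(1))
qed

lemma luxemburg_norm_zero:
  assumes "young_function \<Phi>" "\<And>x. f x = 0"
  shows "luxemburg_norm \<Phi> f = 0"
proof -
  have "luxemburg_norm \<Phi> f \<le> ennreal (1 / real (Suc n))" for n
    using assms by (intro luxemburg_norm_leI) (auto simp: young_function_def)
  moreover have "(\<lambda>n. ennreal (1 / real (Suc n))) \<longlonglongrightarrow> ennreal 0"
    by (intro tendsto_ennrealI LIMSEQ_Suc[OF lim_1_over_n])
  ultimately have "luxemburg_norm \<Phi> f \<le> ennreal 0"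
    by (intro LIMSEQ_le_const) auto
  then show ?thesis by simp
qed



text \<open>
  Convergence in an Orlicz norm implies local convergence in mean. Pairing with a bounded integrable
  function instead of an indicator keeps the Fourier transform of the weight at hand.
  The reason is the linear lower bound for the Young function.
\<close>

lemma luxemburg_norm_dominates_pairing:
  fixes \<phi> :: "real \<Rightarrow> complex"
  assumes \<Phi>: "young_function \<Phi>" and \<phi>: "integrable lebesgue \<phi>" "\<And>x. cmod (\<phi> x) \<le> B"
  shows "\<exists>K>0::real. \<forall>h\<in>borel_measurable lebesgue.
    (\<integral>\<^sup>+x. ennreal (cmod (\<phi> x * h x)) \<partial>lebesgue) \<le> ennreal K * luxemburg_norm \<Phi> h"
proof -
  obtain c y where cy: "0 < c" "0 < y" "\<And>t. 0 \<le> t \<Longrightarrow> ennreal t \<le> ennreal c * \<Phi> t + ennreal y"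
    by (rule young_function_linear_bound[OF \<Phi>]) blast
  define I where "I = (\<integral>x. cmod (\<phi> x) \<partial>lebesgue)"
  have I: "0 \<le> I" "(\<integral>\<^sup>+x. ennreal (cmod (\<phi> x)) \<partial>lebesgue) = ennreal I"
    using \<phi> by (auto simp: I_def nn_integral_eq_integral)
  have B: "0 \<le> B" using norm_ge_zero \<phi>(2) order_trans by blast
  define K where "K = B * c + y * I + 1"
  have K: "0 < K" unfolding K_def using B cy I by (intro add_nonneg_pos add_nonneg_nonneg mult_nonneg_nonneg) auto
  have bound: "(\<integral>\<^sup>+x. ennreal (cmod (\<phi> x * h x)) \<partial>lebesgue) \<le> ennreal K * ennreal l"
    if h[measurable]: "h \<in> borel_measurable lebesgue" and l: "0 < l" "(\<integral>\<^sup>+x. \<Phi> (cmod (h x) / l) \<partial>lebesgue) \<le> 1" for h l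
  proof -
    note [measurable] = young_function_borel[OF \<Phi>] borel_measurable_integrable[OF \<phi>(1)]
    have "ennreal (cmod (\<phi> x * h x)) \<le> ennreal l * (ennreal (B * c) * \<Phi> (cmod (h x) / l) + ennreal y * ennreal (cmod (\<phi> x)))" for x
    proof -
      have "ennreal (cmod (\<phi> x * h x)) = ennreal l * (ennreal (cmod (\<phi> x)) * ennreal (cmod (h x) / l))"
        using l by (simp add: norm_mult flip: ennreal_mult)
      also have "\<dots> \<le> ennreal l * (ennreal (cmod (\<phi> x)) * (ennreal c * \<Phi> (cmod (h x) / l) + ennreal y))"
        using cy l by (intro mult_left_mono) auto
      also have "\<dots> = ennreal l * (ennreal (cmod (\<phi> x)) * (ennreal c * \<Phi> (cmod (h x) / l)) + ennreal y * ennreal (cmod (\<phi> x)))"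
        by (simp add: algebra_simps)
      also have "\<dots> \<le> ennreal l * (ennreal B * (ennreal c * \<Phi> (cmod (h x) / l)) + ennreal y * ennreal (cmod (\<phi> x)))"
        using \<phi>(2) by (intro mult_left_mono add_right_mono mult_right_mono ennreal_leI) auto
      finally show ?thesis using B cy by (simp add: ennreal_mult mult.assoc)
    qed
    then have "(\<integral>\<^sup>+x. ennreal (cmod (\<phi> x * h x)) \<partial>lebesgue)
       \<le> (\<integral>\<^sup>+x. ennreal l * (ennreal (B * c) * \<Phi> (cmod (h x) / l) + ennreal y * ennreal (cmod (\<phi> x))) \<partial>lebesgue)"
      by (intro nn_integral_mono)
    also have "\<dots> = ennreal l * (ennreal (B * c) * (\<integral>\<^sup>+x. \<Phi> (cmod (h x) / l) \<partial>lebesgue) + ennreal y * ennreal I)"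
      by (subst nn_integral_cmult, measurable, subst nn_integral_add, measurable)
         (simp add: nn_integral_cmult I(2))
    also have "\<dots> \<le> ennreal l * (ennreal (B * c) * 1 + ennreal y * ennreal I)"
      using l by (intro mult_left_mono add_right_mono) auto
    also have "\<dots> = ennreal l * ennreal (B * c + y * I)"
      using B cy I by (simp add: ennreal_mult)
    also have "\<dots> \<le> ennreal l * ennreal K"
      by (intro mult_left_mono ennreal_leI) (auto simp: K_def)
    finally show ?thesis by (simp add: mult.commute)
  qed
  have "(\<integral>\<^sup>+x. ennreal (cmod (\<phi> x * h x)) \<partial>lebesgue) \<le> ennreal K * luxemburg_norm \<Phi> h"
    if h: "h \<in> borel_measurable lebesgue" for h
  proof -
    let ?A = "(\<integral>\<^sup>+x. ennreal (cmod (\<phi> x * h x)) \<partial>lebesgue)"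
    have "ennreal (1 / K) * ?A \<le> luxemburg_norm \<Phi> h"
      unfolding luxemburg_norm_def
    proof (rule INF_greatest)
      fix l assume "l \<in> {l. 0 < l \<and> (\<integral>\<^sup>+x. \<Phi> (cmod (h x) / l) \<partial>lebesgue) \<le> 1}"
      then have "?A \<le> ennreal K * ennreal l" using bound[OF h] by auto
      then have "ennreal (1 / K) * ?A \<le> ennreal (1 / K) * (ennreal K * ennreal l)"
        by (intro mult_left_mono) auto
      then show "ennreal (1 / K) * ?A \<le> ennreal l"
        using K by (simp add: mult.assoc[symmetric] flip: ennreal_mult)
    qed
    then have "ennreal K * (ennreal (1 / K) * ?A) \<le> ennreal K * luxemburg_norm \<Phi> h"
      by (intro mult_left_mono) auto
    then show ?thesis
      using K by (simp add: mult.assoc[symmetric] flip: ennreal_mult)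
  qed
  with K show ?thesis by blast
qed

section \<open>Pairing a bilinear multiplier with a test function\<close>

lemma exp_eq_cis:
  "exp (- 2 * complex_of_real pi * \<i> * complex_of_real x * complex_of_real \<xi>) = cis (- (2 * pi * \<xi> * x))"
  "exp (2 * complex_of_real pi * \<i> * complex_of_real \<xi> * complex_of_real x) = cis (2 * pi * \<xi> * x)"
  by (simp_all add: cis_conv_exp mult_ac)

lemma borel_measurable_cis [measurable (raw)]:
  "f \<in> borel_measurable M \<Longrightarrow> (\<lambda>x. cis (f x)) \<in> borel_measurable M"
  by (rule measurable_compose[where N=borel]) (auto intro!: borel_measurable_continuous_onI continuous_intros)

lemma fourier_borel_eq:
  assumes [measurable]: "f \<in> borel_measurable borel"
  shows "fourier f \<xi> = (\<integral>x. f x * cis (- (2 * pi * \<xi> * x)) \<partial>lborel)"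
  unfolding fourier_def exp_eq_cis by (rule integral_completion) measurable

lemma integrable_pair_mult:
  fixes f :: "'a::euclidean_space \<Rightarrow> complex" and g :: "'b::euclidean_space \<Rightarrow> complex"
  assumes f: "integrable lborel f" and g: "integrable lborel g"
  shows "integrable (lborel \<Otimes>\<^sub>M lborel) (\<lambda>(x, y). f x * g y)"
proof (rule lborel_pair.Fubini_integrable)
  note [measurable] = borel_measurable_integrable[OF f] borel_measurable_integrable[OF g]
  show "(\<lambda>(x, y). f x * g y) \<in> borel_measurable (lborel \<Otimes>\<^sub>M lborel)" by measurable
  show "integrable lborel (\<lambda>x. \<integral>y. norm (case (x, y) of (x, y) \<Rightarrow> f x * g y) \<partial>lborel)"
    using f by (simp add: norm_mult)
  show "AE x in lborel. integrable lborel (\<lambda>y. case (x, y) of (x, y) \<Rightarrow> f x * g y)"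
    using g by simp
qed

text \<open>
  The test functions are modulated, translated and dilated Fejer kernels. Modulation moves the
  spectrum, translation shows up as a character, and neither changes a Luxemburg norm.
\<close>

lemma fourier_wave:
  assumes "0 < l"
  shows "fourier (\<lambda>x. cis (2 * pi * a * x) * complex_of_real (vallee_poussin 0 1 (s + l * x))) \<xi>
    = complex_of_real (trapezoid 0 1 ((\<xi> - a) / l) / l) * cis (2 * pi * s * ((\<xi> - a) / l))"
proof -
  let ?v = "vallee_poussin 0 1" and ?z = "(\<xi> - a) / l"
  have "fourier (\<lambda>x. cis (2 * pi * a * x) * complex_of_real (?v (s + l * x))) \<xi>
     = (\<integral>x. cis (2 * pi * a * x) * complex_of_real (?v (s + l * x)) * cis (- (2 * pi * \<xi> * x)) \<partial>lborel)"
    by (rule fourier_borel_eq) measurable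
  also have "\<dots> = (\<integral>x. complex_of_real (?v (s + l * x)) * cis (2 * pi * (- ?z) * (s + l * x)) * cis (2 * pi * s * ?z) \<partial>lborel)"
  proof (intro Bochner_Integration.integral_cong refl)
    fix x
    have "2 * pi * a * x + - (2 * pi * \<xi> * x) = 2 * pi * (- ?z) * (s + l * x) + 2 * pi * s * ?z"
      using assms by (simp add: field_simps)
    then have "cis (2 * pi * a * x) * cis (- (2 * pi * \<xi> * x)) = cis (2 * pi * (- ?z) * (s + l * x)) * cis (2 * pi * s * ?z)"
      unfolding cis_mult by simp
    then show "cis (2 * pi * a * x) * complex_of_real (?v (s + l * x)) * cis (- (2 * pi * \<xi> * x))
      = complex_of_real (?v (s + l * x)) * cis (2 * pi * (- ?z) * (s + l * x)) * cis (2 * pi * s * ?z)"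
      by (simp add: mult_ac)
  qed
  also have "\<dots> = (\<integral>x. complex_of_real (?v (s + l * x)) * cis (2 * pi * (- ?z) * (s + l * x)) \<partial>lborel) * cis (2 * pi * s * ?z)"
    by (rule integral_mult_left_zero)
  also have "(\<integral>x. complex_of_real (?v (s + l * x)) * cis (2 * pi * (- ?z) * (s + l * x)) \<partial>lborel)
      = (\<integral>x. complex_of_real (?v x) * cis (2 * pi * (- ?z) * x) \<partial>lborel) /\<^sub>R l"
    using assms lborel_integral_real_affine[of l "\<lambda>x. complex_of_real (?v x) * cis (2 * pi * (- ?z) * x)" s] by simp
  also have "\<dots> = complex_of_real (trapezoid 0 1 ?z / l)"
    by (subst integral_vallee_poussin_exp) (auto simp: scaleR_conv_of_real divide_inverse mult.commute simp del: minus_divide_left)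
  finally show ?thesis .
qed

text \<open>
  Substituting \<open>u = \<xi> - \<eta>\<close> and integrating out \<open>x\<close> first turns the pairing of \<open>B\<close> with \<open>\<phi>\<close> into an
  integral of \<open>M\<close> against a weight. The functions \<open>p\<close> and \<open>q\<close> stand for the two Fourier transforms; since
  they have compact support, \<open>M\<close> may be cut off to an integrable function, and Fubini's theorem applies.
\<close>

lemma multiplier_pairing:
  fixes M p q \<phi> :: "real \<Rightarrow> complex"
  assumes M[measurable]: "M \<in> borel_measurable borel"
    and int_M: "\<And>R. integrable lborel (\<lambda>u. indicator {- R..R} u *\<^sub>R M u)"
    and p[measurable]: "p \<in> borel_measurable borel" and q[measurable]: "q \<in> borel_measurable borel"
    and p_bound: "\<And>\<xi>. cmod (p \<xi>) \<le> P" and q_bound: "\<And>\<xi>. cmod (q \<xi>) \<le> Q"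
    and p_supp: "\<And>\<xi>. R < \<bar>\<xi>\<bar> \<Longrightarrow> p \<xi> = 0" and q_supp: "\<And>\<xi>. R < \<bar>\<xi>\<bar> \<Longrightarrow> q \<xi> = 0"
    and \<phi>: "integrable lborel \<phi>"
  defines "B \<equiv> \<lambda>x. \<integral>\<eta>. (\<integral>\<xi>. p \<xi> * q \<eta> * M (\<xi> - \<eta>) * cis (2 * pi * (\<xi> + \<eta>) * x) \<partial>lborel) \<partial>lborel"
  shows "B \<in> borel_measurable borel"
    and "(\<integral>x. \<phi> x * B x \<partial>lborel) =
      (\<integral>u. M u * (\<integral>\<eta>. p (u + \<eta>) * q \<eta> * (\<integral>x. \<phi> x * cis (2 * pi * (u + 2 * \<eta>) * x) \<partial>lborel) \<partial>lborel) \<partial>lborel)"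
proof -
  note [measurable] = borel_measurable_integrable[OF \<phi>]
  show "B \<in> borel_measurable borel"
    unfolding B_def by measurable
  define M' where "M' = (\<lambda>u. indicator {- (2 * R)..2 * R} u *\<^sub>R M u)"
  have int_M': "integrable lborel M'"
    unfolding M'_def by (rule int_M)
  have [measurable]: "M' \<in> borel_measurable borel"
    unfolding M'_def by measurable
  \<comment> \<open>Only differences of frequencies in the two supports matter.\<close>
  have MM': "p (u + \<eta>) * q \<eta> * M u = p (u + \<eta>) * q \<eta> * M' u" for u \<eta>
  proof (cases "\<bar>u + \<eta>\<bar> \<le> R \<and> \<bar>\<eta>\<bar> \<le> R")
    case True
    then have "u \<in> {- (2 * R)..2 * R}" by auto
    then show ?thesis by (simp add: M'_def)
  next
    case False
    then have "p (u + \<eta>) = 0 \<or> q \<eta> = 0" using p_supp q_supp by (meson not_le)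
    then show ?thesis by auto
  qed
  define h where "h = (\<lambda>x z. p (snd z + fst z) * q (fst z) * M' (snd z) * cis (2 * pi * (snd z + 2 * fst z) * x))"
  have [measurable]: "fst \<in> borel_measurable (borel :: (real \<times> real) measure)"
      "snd \<in> borel_measurable (borel :: (real \<times> real) measure)"
    by (auto intro!: borel_measurable_continuous_onI continuous_intros)
  have [measurable]: "(\<lambda>(x, z). h x z) \<in> borel_measurable (lborel \<Otimes>\<^sub>M lborel)"
    unfolding h_def by measurable
  have [measurable]: "h x \<in> borel_measurable borel" for x
    unfolding h_def by measurable
  have int_q: "integrable lborel q"
  proof (rule Bochner_Integration.integrable_bound)
    show "integrable lborel (\<lambda>\<eta>. Q * indicator {- R..R} \<eta> :: real)"
      by (intro integrable_mult_right integrable_real_indicator) (auto simp: emeasure_lborel_Icc_eq)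
    show "AE \<eta> in lborel. norm (q \<eta>) \<le> norm (Q * indicator {- R..R} \<eta> :: real)"
    proof (rule AE_I2)
      fix \<eta>
      show "norm (q \<eta>) \<le> norm (Q * indicator {- R..R} \<eta> :: real)"
        using q_bound[of \<eta>] q_supp[of \<eta>] by (cases "\<bar>\<eta>\<bar> \<le> R") (auto simp: indicator_def)
    qed
  qed measurable
  define d where "d = (\<lambda>z. complex_of_real P * (q (fst z) * M' (snd z)))"
  have int_d: "integrable lborel d"
    using integrable_pair_mult[OF int_q int_M'] unfolding d_def lborel_prod
    by (intro integrable_mult_right) (simp add: case_prod_unfold)
  have h_le: "cmod (h x z) \<le> cmod (d z)" for x z
  proof -
    have "0 \<le> P" using p_bound norm_ge_zero order_trans by blast
    then show ?thesis unfolding h_def d_def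
      using p_bound[of "snd z + fst z"] by (simp add: norm_mult mult_right_mono mult.assoc)
  qed
  have int_h: "integrable lborel (h x)" for x
    by (rule Bochner_Integration.integrable_bound[OF int_d]) (use h_le in auto)
  have B: "B x = (\<integral>z. h x z \<partial>lborel)" for x
  proof -
    have "B x = (\<integral>\<eta>. (\<integral>u. h x (\<eta>, u) \<partial>lborel) \<partial>lborel)"
      unfolding B_def
    proof (rule Bochner_Integration.integral_cong[OF refl])
      fix \<eta>
      have "(\<integral>\<xi>. p \<xi> * q \<eta> * M (\<xi> - \<eta>) * cis (2 * pi * (\<xi> + \<eta>) * x) \<partial>lborel)
        = (\<integral>u. p (\<eta> + 1 * u) * q \<eta> * M ((\<eta> + 1 * u) - \<eta>) * cis (2 * pi * ((\<eta> + 1 * u) + \<eta>) * x) \<partial>lborel)"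
        by (subst lborel_integral_real_affine[of 1 _ \<eta>]) auto
      also have "\<dots> = (\<integral>u. h x (\<eta>, u) \<partial>lborel)"
      proof (rule Bochner_Integration.integral_cong[OF refl])
        fix u
        have "\<eta> + 1 * u = u + \<eta>" "u + \<eta> - \<eta> = u" "u + \<eta> + \<eta> = u + 2 * \<eta>" by simp_all
        then show "p (\<eta> + 1 * u) * q \<eta> * M (\<eta> + 1 * u - \<eta>) * cis (2 * pi * (\<eta> + 1 * u + \<eta>) * x) = h x (\<eta>, u)"
          unfolding h_def fst_conv snd_conv by (simp only: MM')
      qed
      finally show "(\<integral>\<xi>. p \<xi> * q \<eta> * M (\<xi> - \<eta>) * cis (2 * pi * (\<xi> + \<eta>) * x) \<partial>lborel) = (\<integral>u. h x (\<eta>, u) \<partial>lborel)" .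
    qed
    also have "\<dots> = (\<integral>z. h x z \<partial>(lborel \<Otimes>\<^sub>M lborel))"
      using int_h[of x] by (intro lborel_pair.integral_fst') (simp add: lborel_prod)
    finally show ?thesis by (simp add: lborel_prod)
  qed
  have int: "integrable (lborel \<Otimes>\<^sub>M lborel) (\<lambda>(x, z). \<phi> x * h x z)"
  proof (rule Bochner_Integration.integrable_bound[OF integrable_pair_mult[OF \<phi> int_d]])
    show "(\<lambda>(x, z). \<phi> x * h x z) \<in> borel_measurable (lborel \<Otimes>\<^sub>M lborel)" by measurable
    show "AE xz in lborel \<Otimes>\<^sub>M lborel. cmod (case xz of (x, z) \<Rightarrow> \<phi> x * h x z) \<le> cmod (case xz of (x, z) \<Rightarrow> \<phi> x * d z)"
      by (intro AE_I2) (auto simp: norm_mult split_beta intro!: mult_left_mono h_le)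
  qed
  define \<psi> where "\<psi> = (\<lambda>v. \<integral>x. \<phi> x * cis (2 * pi * v * x) \<partial>lborel)"
  have inner: "(\<integral>x. \<phi> x * h x z \<partial>lborel) = p (snd z + fst z) * q (fst z) * M' (snd z) * \<psi> (snd z + 2 * fst z)" for z
  proof -
    have "(\<integral>x. \<phi> x * h x z \<partial>lborel) = (\<integral>x. (p (snd z + fst z) * q (fst z) * M' (snd z)) * (\<phi> x * cis (2 * pi * (snd z + 2 * fst z) * x)) \<partial>lborel)"
      by (intro Bochner_Integration.integral_cong) (auto simp: h_def)
    then show ?thesis by (simp add: \<psi>_def)
  qed
  have int2: "integrable (lborel \<Otimes>\<^sub>M lborel) (\<lambda>(\<eta>, u). p (u + \<eta>) * q \<eta> * M' u * \<psi> (u + 2 * \<eta>))"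
    using lborel_pair.integrable_snd[OF int] unfolding inner lborel_prod by (simp only: case_prod_unfold)
  have "(\<integral>x. \<phi> x * B x \<partial>lborel) = (\<integral>x. (\<integral>z. \<phi> x * h x z \<partial>lborel) \<partial>lborel)"
    unfolding B by simp
  also have "\<dots> = (\<integral>z. (\<integral>x. \<phi> x * h x z \<partial>lborel) \<partial>lborel)"
    by (rule lborel_pair.Fubini_integral[OF int, symmetric])
  also have "\<dots> = (\<integral>z. (case z of (\<eta>, u) \<Rightarrow> p (u + \<eta>) * q \<eta> * M' u * \<psi> (u + 2 * \<eta>)) \<partial>(lborel \<Otimes>\<^sub>M lborel))"
    unfolding inner lborel_prod by (simp only: case_prod_unfold)
  also have "\<dots> = (\<integral>u. (\<integral>\<eta>. p (u + \<eta>) * q \<eta> * M' u * \<psi> (u + 2 * \<eta>) \<partial>lborel) \<partial>lborel)"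
    by (rule lborel_pair.integral_snd[OF int2, symmetric])
  also have "\<dots> = (\<integral>u. M u * (\<integral>\<eta>. p (u + \<eta>) * q \<eta> * \<psi> (u + 2 * \<eta>) \<partial>lborel) \<partial>lborel)"
  proof (rule Bochner_Integration.integral_cong[OF refl])
    fix u
    have "(\<integral>\<eta>. p (u + \<eta>) * q \<eta> * M' u * \<psi> (u + 2 * \<eta>) \<partial>lborel) = (\<integral>\<eta>. M u * (p (u + \<eta>) * q \<eta> * \<psi> (u + 2 * \<eta>)) \<partial>lborel)"
    proof (rule Bochner_Integration.integral_cong[OF refl])
      fix \<eta>
      have "p (u + \<eta>) * q \<eta> * M' u * \<psi> (u + 2 * \<eta>) = p (u + \<eta>) * q \<eta> * M u * \<psi> (u + 2 * \<eta>)"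
        by (simp only: MM')
      then show "p (u + \<eta>) * q \<eta> * M' u * \<psi> (u + 2 * \<eta>) = M u * (p (u + \<eta>) * q \<eta> * \<psi> (u + 2 * \<eta>))"
        by (simp only: mult_ac)
    qed
    then show "(\<integral>\<eta>. p (u + \<eta>) * q \<eta> * M' u * \<psi> (u + 2 * \<eta>) \<partial>lborel) = M u * (\<integral>\<eta>. p (u + \<eta>) * q \<eta> * \<psi> (u + 2 * \<eta>) \<partial>lborel)"
      by simp
  qed
  finally show "(\<integral>x. \<phi> x * B x \<partial>lborel) =
      (\<integral>u. M u * (\<integral>\<eta>. p (u + \<eta>) * q \<eta> * (\<integral>x. \<phi> x * cis (2 * pi * (u + 2 * \<eta>) * x) \<partial>lborel) \<partial>lborel) \<partial>lborel)"
    unfolding \<psi>_def .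
qed

lemma bilinear_multiplier_borel_eq:
  assumes [measurable]: "M \<in> borel_measurable borel" "fourier f \<in> borel_measurable borel" "fourier g \<in> borel_measurable borel"
  shows "bilinear_multiplier M f g x =
    (\<integral>\<eta>. (\<integral>\<xi>. fourier f \<xi> * fourier g \<eta> * M (\<xi> - \<eta>) * cis (2 * pi * (\<xi> + \<eta>) * x) \<partial>lborel) \<partial>lborel)"
proof -
  have "(\<integral>\<xi>. fourier f \<xi> * fourier g \<eta> * M (\<xi> - \<eta>) * cis (2 * pi * (\<xi> + \<eta>) * x) \<partial>lebesgue)
    = (\<integral>\<xi>. fourier f \<xi> * fourier g \<eta> * M (\<xi> - \<eta>) * cis (2 * pi * (\<xi> + \<eta>) * x) \<partial>lborel)" for \<eta>
    by (rule integral_completion) measurable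
  then show ?thesis
    unfolding bilinear_multiplier_def exp_eq_cis
    by (simp only:) (rule integral_completion, measurable)
qed

text \<open>
  Lebesgue measure is complete, so measurability passes from one side to the other, and if
  it fails then both integrals are \<open>0\<close> by convention.
\<close>

lemma integral_lebesgue_cong_AE:
  fixes f g :: "real \<Rightarrow> complex"
  assumes "AE x in lebesgue. f x = g x"
  shows "(\<integral>x. f x \<partial>lebesgue) = (\<integral>x. g x \<partial>lebesgue)"
proof (cases "f \<in> borel_measurable lebesgue")
  case True
  then have "g \<in> borel_measurable lebesgue" using assms by (rule borel_measurable_AE)
  with True assms show ?thesis by (intro integral_cong_AE)
next
  case False
  moreover have "g \<notin> borel_measurable lebesgue"
    using False borel_measurable_AE[of g f] assms by (auto simp: eq_commute)
  ultimately show ?thesis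
    by (metis borel_measurable_integrable not_integrable_integral_eq)
qed

text \<open>
  Each section \<open>\<xi> \<mapsto> M (\<xi> - \<eta>)\<close> is a translate, and translates of null sets are null sets.
\<close>

lemma bilinear_multiplier_cong_AE:
  assumes "AE u in lebesgue. M u = M' u"
  shows "bilinear_multiplier M f g = bilinear_multiplier M' f g"
proof -
  have shift: "AE \<xi> in lebesgue. M (\<xi> - \<eta>) = M' (\<xi> - \<eta>)" for \<eta>
  proof -
    have "AE u in lborel. M u = M' u" using assms by (simp add: AE_completion_iff)
    then obtain N where N: "N \<in> sets borel" "emeasure lborel N = 0" "{u. M u \<noteq> M' u} \<subseteq> N"
      by (auto elim!: AE_E)
    have "AE u in lborel. u \<notin> N"
      using N by (intro AE_not_in) (auto simp: null_sets_def)
    then have "AE \<xi> in lborel. - \<eta> + 1 * \<xi> \<notin> N"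
      using N(1) by (intro AE_borel_affine[where P="\<lambda>u. u \<notin> N"]) auto
    then have "AE \<xi> in lborel. M (\<xi> - \<eta>) = M' (\<xi> - \<eta>)"
      using N(3) by (elim eventually_mono) (auto simp: subset_eq)
    then show ?thesis by (rule AE_completion)
  qed
  have "(\<integral>\<xi>. fourier f \<xi> * fourier g \<eta> * M (\<xi> - \<eta>) *
        exp (2 * complex_of_real pi * \<i> * complex_of_real (\<xi> + \<eta>) * complex_of_real x) \<partial>lebesgue) =
     (\<integral>\<xi>. fourier f \<xi> * fourier g \<eta> * M' (\<xi> - \<eta>) *
        exp (2 * complex_of_real pi * \<i> * complex_of_real (\<xi> + \<eta>) * complex_of_real x) \<partial>lebesgue)" for \<eta> x
    by (intro integral_lebesgue_cong_AE eventually_mono[OF shift[of \<eta>]]) simp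
  then show ?thesis unfolding bilinear_multiplier_def by (simp only:)
qed

section \<open>Testing on Fejer kernels\<close>

text \<open>
  The weight that results from the pairing with Fejer kernels, up to scaling and modulation: the first two
  factors come from the two arguments of the bilinear map, the third from the test function.
\<close>

definition overlap :: "real \<Rightarrow> real" where
  "overlap v = (\<integral>y. trapezoid 0 1 (v + y) * trapezoid 0 1 y * trapezoid 0 1 (v + 2 * y) \<partial>lborel)"

lemma overlap_integrand_bound:
  "norm (trapezoid 0 1 (v + y) * trapezoid 0 1 y * trapezoid 0 1 (v + 2 * y)) \<le> indicator {- 1..1} y"
proof (cases "\<bar>y\<bar> \<le> 1")
  case True
  have "trapezoid 0 1 (v + y) * trapezoid 0 1 y * trapezoid 0 1 (v + 2 * y) \<le> 1"
    by (intro mult_le_one mult_nonneg_nonneg trapezoid_bounds)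
  then show ?thesis
    using True by (auto simp: abs_mult trapezoid_bounds indicator_def)
qed (simp add: trapezoid_outside)

lemma integrable_indicator_Icc: "integrable lborel (indicat_real {a..b::real})"
  by (intro integrable_real_indicator) (auto simp: emeasure_lborel_Icc_eq)

lemma integrable_overlap_integrand:
  "integrable lborel (\<lambda>y. trapezoid 0 1 (v + y) * trapezoid 0 1 y * trapezoid 0 1 (v + 2 * y))"
  by (rule Bochner_Integration.integrable_bound[OF integrable_indicator_Icc[of "- 1" 1]])
     (use overlap_integrand_bound in auto)

lemma overlap_nonneg: "0 \<le> overlap v"
  unfolding overlap_def by (intro Bochner_Integration.integral_nonneg mult_nonneg_nonneg trapezoid_bounds)

lemma overlap_le: "overlap v \<le> 2"
proof -
  have "overlap v \<le> (\<integral>y. indicat_real {- 1..1::real} y \<partial>lborel)"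
    unfolding overlap_def
  proof (rule Bochner_Integration.integral_mono[OF integrable_overlap_integrand integrable_indicator_Icc])
    fix y
    show "trapezoid 0 1 (v + y) * trapezoid 0 1 y * trapezoid 0 1 (v + 2 * y) \<le> indicat_real {- 1..1} y"
      using overlap_integrand_bound[of v y] by simp
  qed
  then show ?thesis by simp
qed

lemma overlap_outside: "2 \<le> \<bar>v\<bar> \<Longrightarrow> overlap v = 0"
proof -
  assume v: "2 \<le> \<bar>v\<bar>"
  have "trapezoid 0 1 (v + y) * trapezoid 0 1 y * trapezoid 0 1 (v + 2 * y) = 0" for y
    using v by (cases "1 \<le> \<bar>y\<bar>") (auto simp: trapezoid_outside)
  then show ?thesis unfolding overlap_def by (simp only: Bochner_Integration.integral_zero)
qed

text \<open>
  For arguments up to \<open>1 / 8\<close> and \<open>\<bar>y\<bar> \<le> 1 / 8\<close> the three tents are at least \<open>5 / 8\<close>. Their product is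
  then at least \<open>1 / 5\<close> on an interval of length \<open>1 / 4\<close>.
\<close>

lemma overlap_near_zero: "\<bar>v\<bar> \<le> 1 / 8 \<Longrightarrow> 1 / 20 \<le> overlap v"
proof -
  assume v: "\<bar>v\<bar> \<le> 1 / 8"
  have "(\<integral>y. 1 / 5 * indicat_real {- (1 / 8)..1 / 8 :: real} y \<partial>lborel) \<le> overlap v"
    unfolding overlap_def
  proof (intro Bochner_Integration.integral_mono integrable_overlap_integrand integrable_mult_right integrable_indicator_Icc)
    fix y :: real
    show "1 / 5 * indicat_real {- (1 / 8)..1 / 8 :: real} y
        \<le> trapezoid 0 1 (v + y) * trapezoid 0 1 y * trapezoid 0 1 (v + 2 * y)"
    proof (cases "\<bar>y\<bar> \<le> 1 / 8")
      case True
      have "\<bar>v + y\<bar> \<le> 3 / 8" "\<bar>y\<bar> \<le> 3 / 8" "\<bar>v + 2 * y\<bar> \<le> 3 / 8"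
        using v True by linarith+
      then have "5 / 8 \<le> trapezoid 0 1 (v + y)" "5 / 8 \<le> trapezoid 0 1 y" "5 / 8 \<le> trapezoid 0 1 (v + 2 * y)"
        by (auto simp: trapezoid_def)
      then have "5 / 8 * (5 / 8) * (5 / 8) \<le> trapezoid 0 1 (v + y) * trapezoid 0 1 y * trapezoid 0 1 (v + 2 * y)"
        by (intro mult_mono mult_nonneg_nonneg trapezoid_bounds) auto
      then have "1 / 5 \<le> trapezoid 0 1 (v + y) * trapezoid 0 1 y * trapezoid 0 1 (v + 2 * y)"
        by (rule order_trans[rotated]) simp
      then show ?thesis using True by (simp add: indicator_def)
    next
      case False
      then show ?thesis
        by (auto simp: indicator_def intro!: mult_nonneg_nonneg trapezoid_bounds)
    qed
  qed
  then show ?thesis by simp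
qed

lemma continuous_overlap: "continuous_on UNIV overlap"
proof (rule continuous_on_sequentiallyI)
  fix u :: "nat \<Rightarrow> real" and a assume u: "u \<longlonglongrightarrow> a"
  have cont: "continuous_on UNIV (\<lambda>v. trapezoid 0 1 (v + y) * trapezoid 0 1 y * trapezoid 0 1 (v + 2 * y))" for y
    by (intro continuous_intros) auto
  show "(\<lambda>n. overlap (u n)) \<longlonglongrightarrow> overlap a"
    unfolding overlap_def
  proof (rule integral_dominated_convergence[where w="indicat_real {- 1..1}"])
    show "AE y in lborel. (\<lambda>n. trapezoid 0 1 (u n + y) * trapezoid 0 1 y * trapezoid 0 1 (u n + 2 * y))
        \<longlonglongrightarrow> trapezoid 0 1 (a + y) * trapezoid 0 1 y * trapezoid 0 1 (a + 2 * y)"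
      by (intro AE_I2 continuous_on_tendsto_compose[OF cont u]) auto
    show "AE y in lborel. norm (trapezoid 0 1 (u n + y) * trapezoid 0 1 y * trapezoid 0 1 (u n + 2 * y)) \<le> indicat_real {- 1..1} y" for n
      by (intro AE_I2 overlap_integrand_bound)
  qed (auto simp: integrable_indicator_Icc)
qed

lemma borel_measurable_overlap [measurable]: "overlap \<in> borel_measurable borel"
  using continuous_overlap by (rule borel_measurable_continuous_onI)

lemma integrable_overlap: "integrable lborel overlap"
proof (rule Bochner_Integration.integrable_bound[of _ "\<lambda>v. 2 * indicat_real {- 2..2} v"])
  show "AE v in lborel. norm (overlap v) \<le> norm (2 * indicat_real {- 2..2} v)"
  proof (rule AE_I2)
    fix v show "norm (overlap v) \<le> norm (2 * indicat_real {- 2..2} v)"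
      using overlap_nonneg[of v] overlap_le[of v] overlap_outside[of v]
      by (cases "\<bar>v\<bar> \<le> 2") (auto simp: indicator_def)
  qed
qed (auto intro: integrable_indicator_Icc)

lemma overlap_integral_pos: "0 < (\<integral>v. overlap v \<partial>lborel)"
proof -
  have "(\<integral>v. 1 / 20 * indicat_real {- (1 / 8)..1 / 8 :: real} v \<partial>lborel) \<le> (\<integral>v. overlap v \<partial>lborel)"
    by (intro Bochner_Integration.integral_mono integrable_mult_right integrable_indicator_Icc integrable_overlap)
       (use overlap_near_zero overlap_nonneg in \<open>auto simp: indicator_def\<close>)
  then show ?thesis by simp
qed

lemma luxemburg_norm_wave_le:
  assumes \<Phi>: "young_function \<Phi>" and l: "0 < l"
  shows "luxemburg_norm \<Phi> (\<lambda>x. cis (2 * pi * a * x) * complex_of_real (vallee_poussin 0 1 (s + l * x)))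
    \<le> dilation_norm \<Phi> l * luxemburg_norm \<Phi> (\<lambda>x. complex_of_real (vallee_poussin 0 1 x))"
    and "luxemburg_norm \<Phi> (\<lambda>x. complex_of_real (vallee_poussin 0 1 x)) < \<infinity>"
proof -
  let ?k = "\<lambda>x. complex_of_real (vallee_poussin 0 1 x)"
  have k_meas: "?k \<in> borel_measurable lebesgue"
    by (intro measurable_completion) measurable
  have ks_meas: "(\<lambda>x. ?k (s + x)) \<in> borel_measurable lebesgue"
    by (intro measurable_completion) measurable
  have k_int: "integrable lebesgue ?k"
    by (subst integrable_completion) (auto intro!: integrable_of_real integrable_vallee_poussin)
  obtain B where "\<And>x. \<bar>vallee_poussin 0 1 x\<bar> \<le> B"
    using bounded_vallee_poussin by blast
  then show fin: "luxemburg_norm \<Phi> ?k < \<infinity>"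
    by (intro luxemburg_norm_finite[OF \<Phi> k_int, of B]) simp
  have "luxemburg_norm \<Phi> (\<lambda>x. cis (2 * pi * a * x) * ?k (s + l * x)) = luxemburg_norm \<Phi> (dilation l (\<lambda>x. ?k (s + x)))"
    by (rule luxemburg_norm_cong) (simp add: norm_mult dilation_def)
  also have "\<dots> \<le> dilation_norm \<Phi> l * luxemburg_norm \<Phi> (\<lambda>x. ?k (s + x))"
    using fin by (intro luxemburg_norm_dilation_le[OF \<Phi> l ks_meas]) (simp add: luxemburg_norm_translate[OF \<Phi> k_meas])
  finally show "luxemburg_norm \<Phi> (\<lambda>x. cis (2 * pi * a * x) * ?k (s + l * x)) \<le> dilation_norm \<Phi> l * luxemburg_norm \<Phi> ?k"
    by (simp add: luxemburg_norm_translate[OF \<Phi> k_meas])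
qed

lemma wave_compact_spectrum:
  assumes l: "0 < l"
  shows "(\<lambda>x. cis (2 * pi * a * x) * complex_of_real (vallee_poussin 0 1 (s + l * x))) \<in> compact_spectrum"
proof -
  let ?F = "\<lambda>x. cis (2 * pi * a * x) * complex_of_real (vallee_poussin 0 1 (s + l * x))"
  have "integrable lborel ?F"
  proof (rule Bochner_Integration.integrable_bound)
    show "integrable lborel (\<lambda>x. vallee_poussin 0 1 (s + l * x))"
      using l by (intro lborel_integrable_real_affine integrable_vallee_poussin) auto
    show "AE x in lborel. norm (?F x) \<le> norm (vallee_poussin 0 1 (s + l * x))"
      by (simp add: norm_mult)
  qed measurable
  then have "integrable lebesgue ?F"
    by (subst integrable_completion) auto
  moreover have "{\<xi>. fourier ?F \<xi> \<noteq> 0} \<subseteq> {a - l..a + l}"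
  proof
    fix \<xi> assume "\<xi> \<in> {\<xi>. fourier ?F \<xi> \<noteq> 0}"
    then have "trapezoid 0 1 ((\<xi> - a) / l) \<noteq> 0"
      by (auto simp: fourier_wave[OF l])
    then have "\<not> 1 \<le> \<bar>(\<xi> - a) / l\<bar>" using trapezoid_outside[of 0 1] by auto
    then show "\<xi> \<in> {a - l..a + l}" using l by (auto simp: field_simps abs_if split: if_splits)
  qed
  then have "compact (closure {\<xi>. fourier ?F \<xi> \<noteq> 0})"
    using bounded_subset[OF bounded_closed_interval] by (auto simp: compact_closure)
  ultimately show ?thesis by (simp add: compact_spectrum_def)
qed

text \<open>
  The central estimate. The bilinear map is applied to two Fejer kernels at scale \<open>l\<close>, the first one
  modulated by \<open>a\<close>, the two of them translated in opposite directions. The result is dilated by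
  \<open>1 / l\<close> and paired with a fixed kernel. This costs the three dilation norms and constants that depend
  neither on \<open>l\<close> nor on \<open>a\<close> and \<open>t\<close>. The uniformity in \<open>a\<close> and \<open>t\<close> is what both limiting arguments
  below rest on.
\<close>

lemma multiplier_test_estimate:
  assumes \<Phi>: "young_function \<Phi>1" "young_function \<Phi>2" "young_function \<Phi>3"
    and M: "M \<in> multiplier_space \<Phi>1 \<Phi>2 \<Phi>3" and [measurable]: "M \<in> borel_measurable borel"
    and int_M: "\<And>R. integrable lborel (\<lambda>u. indicator {- R..R} u *\<^sub>R M u)"
  obtains K :: real where "0 \<le> K" "\<And>l a t. 0 < l \<Longrightarrow>
    ennreal (cmod (\<integral>u. M u * (cis (2 * pi * t * (u - a)) * complex_of_real (overlap ((u - a) / l))) \<partial>lborel))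
    \<le> ennreal K * (ennreal l * dilation_norm \<Phi>1 l * dilation_norm \<Phi>2 l * dilation_norm \<Phi>3 (1 / l))"
proof -
  let ?v = "vallee_poussin 0 1" and ?tri = "trapezoid 0 1"
  let ?k = "\<lambda>x. complex_of_real (?v x)"
  obtain C :: real where C: "0 < C" "\<And>f g. f \<in> compact_spectrum \<Longrightarrow> g \<in> compact_spectrum \<Longrightarrow>
      luxemburg_norm \<Phi>3 (bilinear_multiplier M f g) \<le> ennreal C * luxemburg_norm \<Phi>1 f * luxemburg_norm \<Phi>2 g"
    using M unfolding multiplier_space_def by blast
  obtain b where b: "\<And>x. \<bar>?v x\<bar> \<le> b" using bounded_vallee_poussin by blast
  have k_int: "integrable lebesgue ?k"
    by (subst integrable_completion) (auto intro!: integrable_of_real integrable_vallee_poussin)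
  obtain K0 :: real where K0: "0 < K0" "\<And>h. h \<in> borel_measurable lebesgue \<Longrightarrow>
      (\<integral>\<^sup>+x. ennreal (cmod (?k x * h x)) \<partial>lebesgue) \<le> ennreal K0 * luxemburg_norm \<Phi>3 h"
    using luxemburg_norm_dominates_pairing[OF \<Phi>(3) k_int, of b] b by auto
  define n1 where "n1 = enn2real (luxemburg_norm \<Phi>1 ?k)"
  define n2 where "n2 = enn2real (luxemburg_norm \<Phi>2 ?k)"
  have n1: "luxemburg_norm \<Phi>1 ?k = ennreal n1" "0 \<le> n1"
    using luxemburg_norm_wave_le(2)[OF \<Phi>(1) zero_less_one] by (auto simp: n1_def)
  have n2: "luxemburg_norm \<Phi>2 ?k = ennreal n2" "0 \<le> n2"
    using luxemburg_norm_wave_le(2)[OF \<Phi>(2) zero_less_one] by (auto simp: n2_def)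
  have estimate: "ennreal (cmod (\<integral>u. M u * (cis (2 * pi * t * (u - a)) * complex_of_real (overlap ((u - a) / l))) \<partial>lborel))
    \<le> ennreal (K0 * C * n1 * n2) * (ennreal l * dilation_norm \<Phi>1 l * dilation_norm \<Phi>2 l * dilation_norm \<Phi>3 (1 / l))"
    if l: "0 < l" for l a t :: real
  proof -
    \<comment> \<open>Opposite translations by \<open>s\<close> contribute the character of frequency \<open>s / l = t\<close> in \<open>\<xi> - \<eta>\<close>;\<close>
    \<comment> \<open>the test function carries the opposite modulation because its transform is evaluated at \<open>- (\<xi> + \<eta>)\<close>.\<close>
    define s where "s = t * l"
    define F where "F = (\<lambda>x. cis (2 * pi * a * x) * ?k (s + l * x))"
    define G where "G = (\<lambda>x. cis (2 * pi * 0 * x) * ?k (- s + l * x))"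
    define \<phi> where "\<phi> = (\<lambda>x. cis (2 * pi * (- a) * x) * ?k (0 + l * x))"
    note hats = fourier_wave[OF l, of a s, folded F_def] fourier_wave[OF l, of 0 "- s", folded G_def]
      fourier_wave[OF l, of "- a" 0, folded \<phi>_def]
    have [measurable]: "F \<in> borel_measurable borel" "G \<in> borel_measurable borel" "\<phi> \<in> borel_measurable borel"
      unfolding F_def G_def \<phi>_def by measurable
    have [measurable]: "fourier F \<in> borel_measurable borel" "fourier G \<in> borel_measurable borel"
      unfolding hats[abs_def] by measurable
    have \<phi>_int: "integrable lborel \<phi>"
      using wave_compact_spectrum[OF l, of "- a" 0] unfolding \<phi>_def[symmetric] compact_spectrum_def
      by (auto simp: integrable_completion)
    define B where "B = bilinear_multiplier M F G"
    have B_eq: "B = (\<lambda>x. \<integral>\<eta>. (\<integral>\<xi>. fourier F \<xi> * fourier G \<eta> * M (\<xi> - \<eta>) * cis (2 * pi * (\<xi> + \<eta>) * x) \<partial>lborel) \<partial>lborel)"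
      unfolding B_def by (intro ext bilinear_multiplier_borel_eq) measurable
    define R where "R = \<bar>a\<bar> + l"
    have F_supp: "fourier F \<xi> = 0" "fourier G \<xi> = 0" if "R < \<bar>\<xi>\<bar>" for \<xi>
    proof -
      have "1 \<le> \<bar>(\<xi> - a) / l\<bar>" "1 \<le> \<bar>(\<xi> - 0) / l\<bar>"
        using that l by (auto simp: R_def)
      then show "fourier F \<xi> = 0" "fourier G \<xi> = 0"
        unfolding hats by (auto simp: trapezoid_outside)
    qed
    have hat_bound: "cmod (fourier F \<xi>) \<le> 1 / l" "cmod (fourier G \<xi>) \<le> 1 / l" for \<xi>
      unfolding hats using l
      by (auto simp: norm_mult norm_divide trapezoid_bounds intro!: divide_right_mono)
    note pairing = multiplier_pairing[OF \<open>M \<in> borel_measurable borel\<close> int_M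
      \<open>fourier F \<in> borel_measurable borel\<close> \<open>fourier G \<in> borel_measurable borel\<close> hat_bound F_supp \<phi>_int]
    have B_meas[measurable]: "B \<in> borel_measurable borel"
      unfolding B_eq by (rule pairing(1))
    have B_pairing: "(\<integral>x. \<phi> x * B x \<partial>lborel) = (\<integral>u. M u * (\<integral>\<eta>. fourier F (u + \<eta>) * fourier G \<eta> *
        (\<integral>x. \<phi> x * cis (2 * pi * (u + 2 * \<eta>) * x) \<partial>lborel) \<partial>lborel) \<partial>lborel)"
      unfolding B_eq by (rule pairing(2))
    have inner: "(\<integral>\<eta>. fourier F (u + \<eta>) * fourier G \<eta> * (\<integral>x. \<phi> x * cis (2 * pi * (u + 2 * \<eta>) * x) \<partial>lborel) \<partial>lborel)
      = complex_of_real (1 / l\<^sup>2) * (cis (2 * pi * t * (u - a)) * complex_of_real (overlap ((u - a) / l)))" for u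
    proof -
      have \<phi>hat: "(\<integral>x. \<phi> x * cis (2 * pi * w * x) \<partial>lborel) = complex_of_real (?tri ((w - a) / l) / l)" for w
      proof -
        have "(\<integral>x. \<phi> x * cis (2 * pi * w * x) \<partial>lborel) = fourier \<phi> (- w)"
          by (subst fourier_borel_eq) auto
        also have "\<dots> = complex_of_real (?tri (- ((w - a) / l)) / l)"
          unfolding hats by (simp add: minus_divide_left)
        finally show ?thesis by simp
      qed
      let ?g = "\<lambda>y. ?tri ((u - a) / l + y) * ?tri y * ?tri ((u - a) / l + 2 * y)"
      have "(\<integral>\<eta>. fourier F (u + \<eta>) * fourier G \<eta> * (\<integral>x. \<phi> x * cis (2 * pi * (u + 2 * \<eta>) * x) \<partial>lborel) \<partial>lborel)
        = (\<integral>\<eta>. complex_of_real (1 / l ^ 3) * cis (2 * pi * t * (u - a)) * complex_of_real (?g (0 + 1 / l * \<eta>)) \<partial>lborel)"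
      proof (rule Bochner_Integration.integral_cong[OF refl])
        fix \<eta>
        have "2 * pi * s * ((u + \<eta> - a) / l) + 2 * pi * (- s) * ((\<eta> - 0) / l) = 2 * pi * t * (u - a)"
          using l by (simp add: s_def field_simps)
        then have cis: "cis (2 * pi * s * ((u + \<eta> - a) / l)) * cis (2 * pi * (- s) * ((\<eta> - 0) / l)) = cis (2 * pi * t * (u - a))"
          by (simp only: cis_mult)
        have "(u + \<eta> - a) / l = (u - a) / l + (0 + 1 / l * \<eta>)" "(\<eta> - 0) / l = 0 + 1 / l * \<eta>"
          "(u + 2 * \<eta> - a) / l = (u - a) / l + 2 * (0 + 1 / l * \<eta>)"
          by (simp_all add: add_divide_distrib diff_divide_distrib)
        note eqs = this
        have "fourier F (u + \<eta>) * fourier G \<eta> * (\<integral>x. \<phi> x * cis (2 * pi * (u + 2 * \<eta>) * x) \<partial>lborel)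
          = complex_of_real (?tri ((u + \<eta> - a) / l) / l) * complex_of_real (?tri ((\<eta> - 0) / l) / l)
            * complex_of_real (?tri ((u + 2 * \<eta> - a) / l) / l)
            * (cis (2 * pi * s * ((u + \<eta> - a) / l)) * cis (2 * pi * (- s) * ((\<eta> - 0) / l)))"
          unfolding hats \<phi>hat by (simp only: mult_ac)
        also have "\<dots> = complex_of_real (1 / l ^ 3) * cis (2 * pi * t * (u - a)) * complex_of_real (?g (0 + 1 / l * \<eta>))"
          unfolding cis unfolding eqs by (simp add: power3_eq_cube)
        finally show "fourier F (u + \<eta>) * fourier G \<eta> * (\<integral>x. \<phi> x * cis (2 * pi * (u + 2 * \<eta>) * x) \<partial>lborel)
          = complex_of_real (1 / l ^ 3) * cis (2 * pi * t * (u - a)) * complex_of_real (?g (0 + 1 / l * \<eta>))" .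
      qed
      also have "\<dots> = complex_of_real (1 / l ^ 3) * cis (2 * pi * t * (u - a)) * complex_of_real (\<integral>\<eta>. ?g (0 + 1 / l * \<eta>) \<partial>lborel)"
        by (simp only: integral_mult_right_zero integral_complex_of_real)
      also have "(\<integral>\<eta>. ?g (0 + 1 / l * \<eta>) \<partial>lborel) = l * overlap ((u - a) / l)"
        using l lborel_integral_real_affine[of "1 / l" ?g 0] unfolding overlap_def by simp
      also have "complex_of_real (1 / l ^ 3) * cis (2 * pi * t * (u - a)) * complex_of_real (l * overlap ((u - a) / l))
        = complex_of_real (1 / l\<^sup>2) * (cis (2 * pi * t * (u - a)) * complex_of_real (overlap ((u - a) / l)))"
        using l by (simp add: power2_eq_square power3_eq_cube)
      finally show ?thesis .
    qed
    have eq: "(\<integral>u. M u * (cis (2 * pi * t * (u - a)) * complex_of_real (overlap ((u - a) / l))) \<partial>lborel)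
      = complex_of_real (l\<^sup>2) * (\<integral>x. \<phi> x * B x \<partial>lborel)"
    proof -
      have "(\<integral>x. \<phi> x * B x \<partial>lborel) = (\<integral>u. complex_of_real (1 / l\<^sup>2) *
          (M u * (cis (2 * pi * t * (u - a)) * complex_of_real (overlap ((u - a) / l)))) \<partial>lborel)"
        unfolding B_pairing inner by (simp only: mult_ac)
      then show ?thesis using l by simp
    qed
    have "ennreal (cmod (\<integral>x. \<phi> x * B x \<partial>lborel)) \<le> (\<integral>\<^sup>+x. ennreal (cmod (\<phi> x * B x)) \<partial>lborel)"
      by (cases "integrable lborel (\<lambda>x. \<phi> x * B x)")
         (auto intro: integral_norm_bound_ennreal simp: not_integrable_integral_eq)
    also have "\<dots> = (\<integral>\<^sup>+x. ennreal (cmod (?k (0 + l * x) * dilation (1 / l) B (0 + l * x))) \<partial>lborel)"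
      using l by (intro nn_integral_cong) (simp add: \<phi>_def norm_mult dilation_def)
    also have "\<dots> = ennreal (1 / l) * (\<integral>\<^sup>+x. ennreal (cmod (?k x * dilation (1 / l) B x)) \<partial>lborel)"
    proof -
      have [measurable]: "dilation (1 / l) B \<in> borel_measurable borel"
        unfolding dilation_def by measurable
      show ?thesis
        using l by (subst (2) nn_integral_real_affine[where c=l and t=0])
          (auto simp: mult.assoc[symmetric] simp flip: ennreal_mult)
    qed
    also have "(\<integral>\<^sup>+x. ennreal (cmod (?k x * dilation (1 / l) B x)) \<partial>lborel) \<le> ennreal K0 * luxemburg_norm \<Phi>3 (dilation (1 / l) B)"
    proof -
      have "dilation (1 / l) B \<in> borel_measurable lebesgue"
        unfolding dilation_def by (intro measurable_completion) measurable
      from K0(2)[OF this] show ?thesis by (simp add: nn_integral_completion)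
    qed
    finally have 1: "ennreal (cmod (\<integral>x. \<phi> x * B x \<partial>lborel)) \<le> ennreal (1 / l) * (ennreal K0 * luxemburg_norm \<Phi>3 (dilation (1 / l) B))"
      by (auto simp: mult_left_mono)
    have 2: "luxemburg_norm \<Phi>3 B \<le> ennreal C * (dilation_norm \<Phi>1 l * ennreal n1) * (dilation_norm \<Phi>2 l * ennreal n2)"
    proof -
      have "luxemburg_norm \<Phi>3 B \<le> ennreal C * luxemburg_norm \<Phi>1 F * luxemburg_norm \<Phi>2 G"
        unfolding B_def F_def G_def by (intro C(2) wave_compact_spectrum l)
      also have "\<dots> \<le> ennreal C * (dilation_norm \<Phi>1 l * ennreal n1) * (dilation_norm \<Phi>2 l * ennreal n2)"
        using luxemburg_norm_wave_le(1)[OF \<Phi>(1) l, of a s] luxemburg_norm_wave_le(1)[OF \<Phi>(2) l, of 0 "- s"]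
        unfolding n1 n2 F_def[symmetric] G_def[symmetric] by (intro mult_mono order_refl) auto
      finally show ?thesis .
    qed
    have fin: "luxemburg_norm \<Phi>3 B < \<infinity>"
      using 2 dilation_norm_finite[OF \<Phi>(1) l] dilation_norm_finite[OF \<Phi>(2) l]
      by (auto simp: ennreal_mult_less_top order_le_less_trans)
    have B_leb: "B \<in> borel_measurable lebesgue" by (intro measurable_completion) measurable
    have 3: "luxemburg_norm \<Phi>3 (dilation (1 / l) B) \<le> dilation_norm \<Phi>3 (1 / l) * luxemburg_norm \<Phi>3 B"
      using l by (intro luxemburg_norm_dilation_le[OF \<Phi>(3) _ B_leb fin]) auto
    have "ennreal (cmod (\<integral>u. M u * (cis (2 * pi * t * (u - a)) * complex_of_real (overlap ((u - a) / l))) \<partial>lborel))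
      = ennreal (l\<^sup>2) * ennreal (cmod (\<integral>x. \<phi> x * B x \<partial>lborel))"
      unfolding eq by (simp add: norm_mult norm_power ennreal_mult)
    also have "\<dots> \<le> ennreal (l\<^sup>2) * (ennreal (1 / l) * (ennreal K0 * (dilation_norm \<Phi>3 (1 / l) *
        (ennreal C * (dilation_norm \<Phi>1 l * ennreal n1) * (dilation_norm \<Phi>2 l * ennreal n2)))))"
      by (intro mult_left_mono order_trans[OF 1] order_trans[OF 3] 2) auto
    also have "\<dots> = ennreal (l\<^sup>2) * ennreal (1 / l) * (ennreal K0 * ennreal C * ennreal n1 * ennreal n2)
        * (dilation_norm \<Phi>1 l * dilation_norm \<Phi>2 l * dilation_norm \<Phi>3 (1 / l))"
      by (simp only: mult_ac)
    also have "ennreal (l\<^sup>2) * ennreal (1 / l) = ennreal l"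
      using l by (simp add: power2_eq_square flip: ennreal_mult)
    also have "ennreal K0 * ennreal C * ennreal n1 * ennreal n2 = ennreal (K0 * C * n1 * n2)"
      using K0 C n1 n2 by (simp add: ennreal_mult)
    finally show ?thesis by (simp only: mult_ac)
  qed
  show ?thesis
    by (rule that[of "K0 * C * n1 * n2"]) (use K0(1) C(1) n1(2) n2(2) estimate in auto)
qed

section \<open>From the estimate to vanishing integrals\<close>

text \<open>
  Intervals generate the Borel sets and are stable under intersection, and \<open>M\<close> is integrable on bounded
  intervals; so all integrals over bounded Borel sets vanish.
\<close>

lemma AE_zero_if_interval_integrals_zero:
  fixes M :: "real \<Rightarrow> complex"
  assumes int_M: "\<And>R. integrable lborel (\<lambda>u. indicator {- R..R} u *\<^sub>R M u)"
    and zero: "\<And>p q. p \<le> q \<Longrightarrow> (\<integral>u. indicator {p..q} u *\<^sub>R M u \<partial>lborel) = 0"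
  shows "AE u in lborel. M u = 0"
proof -
  have "AE u in lborel. indicator {- real n..real n} u *\<^sub>R M u = 0" for n
  proof (rule sigma_finite_measure.density_zero[OF lborel.sigma_finite_measure_axioms int_M])
    let ?f = "\<lambda>u. indicator {- real n..real n} u *\<^sub>R M u"
    have int: "set_integrable lborel A ?f" if "A \<in> sets borel" for A
      unfolding set_integrable_def using that by (intro integrable_mult_indicator int_M) auto
    fix A :: "real set" assume "A \<in> sets lborel"
    then have "A \<in> sets borel" by simp
    then show "set_lebesgue_integral lborel A ?f = 0"
    proof (induction rule: borel_set_induct)
      case empty
      show ?case by (simp add: set_lebesgue_integral_def)
    next
      case (interval a b)
      have "indicator {a..b} u *\<^sub>R ?f u = indicator {max a (- real n)..min b (real n)} u *\<^sub>R M u" for u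
        by (auto simp: indicator_def)
      then show ?case
        unfolding set_lebesgue_integral_def
        by (cases "max a (- real n) \<le> min b (real n)") (simp_all only: zero, simp)
    next
      case (compl A)
      have "set_lebesgue_integral lborel (A \<union> - A) ?f = set_lebesgue_integral lborel A ?f + set_lebesgue_integral lborel (- A) ?f"
        using compl by (intro set_integral_Un int) auto
      then show ?case
        using compl zero[of "- real n" "real n"] by (simp add: set_lebesgue_integral_def)
    next
      case (union A)
      then show ?case
        by (subst lebesgue_integral_countable_add) (auto simp: disjoint_family_on_def intro!: int)
    qed
  qed
  then have "AE u in lborel. \<forall>n. indicator {- real n..real n} u *\<^sub>R M u = 0"
    unfolding AE_all_countable by blast
  then show ?thesis
  proof (rule eventually_mono)
    fix u assume *: "\<forall>n. indicator {- real n..real n} u *\<^sub>R M u = 0"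
    obtain n :: nat where "\<bar>u\<bar> \<le> real n" using real_arch_simple by blast
    with *[rule_format, of n] show "M u = 0" by (auto simp: indicator_def abs_le_iff split: if_splits)
  qed
qed

text \<open>
  As the scale tends to \<open>0\<close>, the weights \<open>overlap ((u - a) / l) / l\<close> form an approximate identity
  up to the factor \<open>\<integral> overlap\<close>. Integrating the estimate over \<open>a \<in> [p, q]\<close> replaces differentiation at Lebesgue points.
\<close>

lemma interval_integral_zero_if_small_at_fine_scales:
  fixes M :: "real \<Rightarrow> complex" and l e :: "nat \<Rightarrow> real"
  assumes [measurable]: "M \<in> borel_measurable borel"
    and int_M: "\<And>R. integrable lborel (\<lambda>u. indicator {- R..R} u *\<^sub>R M u)"
    and l: "\<And>n. 0 < l n" "\<And>n. l n \<le> 1" "l \<longlonglongrightarrow> 0" and e: "e \<longlonglongrightarrow> 0"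
    and small: "\<And>n a. cmod (\<integral>u. M u * complex_of_real (overlap ((u - a) / l n)) \<partial>lborel) \<le> l n * e n"
    and pq: "p \<le> q"
  shows "(\<integral>u. indicator {p..q} u *\<^sub>R M u \<partial>lborel) = 0"
proof -
  define m where "m = (\<integral>v. overlap v \<partial>lborel)"
  define V where "V = (\<lambda>n u. \<integral>v. indicator {p..q} (u - l n * v) * overlap v \<partial>lborel)"
  define T where "T = (\<lambda>n. \<integral>u. M u * complex_of_real (V n u) \<partial>lborel)"
  define R where "R = \<bar>p\<bar> + \<bar>q\<bar> + 2"
  have V_int: "integrable lborel (\<lambda>v. indicator {p..q} (u - l n * v) * overlap v)" for n u
    by (rule Bochner_Integration.integrable_bound[OF integrable_overlap])
       (auto simp: abs_mult indicator_def)
  have [measurable]: "V n \<in> borel_measurable borel" for n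
    unfolding V_def by measurable
  have V_bounds: "0 \<le> V n u" "V n u \<le> m" for n u
  proof -
    show "0 \<le> V n u"
      unfolding V_def by (intro Bochner_Integration.integral_nonneg mult_nonneg_nonneg overlap_nonneg) auto
    show "V n u \<le> m"
      unfolding V_def m_def
      by (intro Bochner_Integration.integral_mono V_int integrable_overlap) (auto simp: indicator_def overlap_nonneg)
  qed
  have V_outside: "V n u = 0" if "R < \<bar>u\<bar>" for n u
  proof -
    have "indicator {p..q} (u - l n * v) * overlap v = 0" for v
    proof (cases "2 \<le> \<bar>v\<bar>")
      case False
      have "\<bar>l n * v\<bar> \<le> 1 * 2" unfolding abs_mult using False l(1,2)[of n] by (intro mult_mono) auto
      then have "u - l n * v \<notin> {p..q}" using that by (auto simp: R_def)
      then show ?thesis by simp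
    qed (simp add: overlap_outside)
    then show ?thesis unfolding V_def by (simp only: Bochner_Integration.integral_zero)
  qed
  have "(\<lambda>n. T n) \<longlonglongrightarrow> (\<integral>u. M u * complex_of_real (indicator {p..q} u * m) \<partial>lborel)"
    unfolding T_def
  proof (rule integral_dominated_convergence[where w="\<lambda>u. m * cmod (indicator {- R..R} u *\<^sub>R M u)"])
    show "integrable lborel (\<lambda>u. m * cmod (indicator {- R..R} u *\<^sub>R M u))"
      by (intro integrable_mult_right integrable_norm int_M)
    show "AE u in lborel. cmod (M u * complex_of_real (V n u)) \<le> m * cmod (indicator {- R..R} u *\<^sub>R M u)" for n
    proof (rule AE_I2)
      fix u
      show "cmod (M u * complex_of_real (V n u)) \<le> m * cmod (indicator {- R..R} u *\<^sub>R M u)"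
        using V_bounds[of n u] V_outside[of u n]
        by (cases "\<bar>u\<bar> \<le> R") (auto simp: norm_mult abs_le_iff mult.commute[of "cmod (M u)"] intro!: mult_right_mono)
    qed
    \<comment> \<open>At the two endpoints the limit is only a part of \<open>m\<close>.\<close>
    have "AE u in lborel. u \<notin> {p, q}"
      by (intro AE_not_in finite_imp_null_set_lborel) auto
    then show "AE u in lborel. (\<lambda>n. M u * complex_of_real (V n u)) \<longlonglongrightarrow> M u * complex_of_real (indicator {p..q} u * m)"
    proof (rule eventually_mono)
      fix u assume u: "u \<notin> {p, q}"
      have "(\<lambda>n. V n u) \<longlonglongrightarrow> (\<integral>v. indicator {p..q} u * overlap v \<partial>lborel)"
        unfolding V_def
      proof (rule integral_dominated_convergence[where w=overlap])
        show "AE v in lborel. (\<lambda>n. indicator {p..q} (u - l n * v) * overlap v) \<longlonglongrightarrow> indicator {p..q} u * overlap v"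
        proof (rule AE_I2)
          fix v
          have lim: "(\<lambda>n. u - l n * v) \<longlonglongrightarrow> u"
            using tendsto_diff[OF tendsto_const[of u] tendsto_mult[OF l(3) tendsto_const[of v]]] by simp
          have "\<forall>\<^sub>F n in sequentially. indicator {p..q} (u - l n * v) = indicat_real {p..q} u"
          proof (cases "u \<in> {p<..<q}")
            case True
            have "\<forall>\<^sub>F n in sequentially. u - l n * v \<in> {p<..<q}"
              using lim True by (intro topological_tendstoD) auto
            then show ?thesis
              using True by (auto elim!: eventually_mono simp: indicator_def)
          next
            case False
            then have "u \<in> - {p..q}" using u by auto
            then have "\<forall>\<^sub>F n in sequentially. u - l n * v \<in> - {p..q}"
              using lim by (intro topological_tendstoD) auto
            then show ?thesis
              using \<open>u \<in> - {p..q}\<close> by (auto elim!: eventually_mono simp: indicator_def)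
          qed
          then have "(\<lambda>n. indicat_real {p..q} (u - l n * v)) \<longlonglongrightarrow> indicator {p..q} u"
            by (rule tendsto_eventually)
          then show "(\<lambda>n. indicator {p..q} (u - l n * v) * overlap v) \<longlonglongrightarrow> indicator {p..q} u * overlap v"
            by (intro tendsto_mult tendsto_const)
        qed
        show "AE v in lborel. norm (indicator {p..q} (u - l n * v) * overlap v) \<le> overlap v" for n
          by (auto simp: indicator_def overlap_nonneg)
      qed (auto simp: integrable_overlap)
      then have "(\<lambda>n. V n u) \<longlonglongrightarrow> indicator {p..q} u * m"
        by (simp add: m_def)
      then show "(\<lambda>n. M u * complex_of_real (V n u)) \<longlonglongrightarrow> M u * complex_of_real (indicator {p..q} u * m)"
        by (intro tendsto_mult tendsto_const tendsto_of_real)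
    qed
  qed measurable
  moreover have "(\<lambda>n. T n) \<longlonglongrightarrow> 0"
  proof (rule Lim_null_comparison)
    show "(\<lambda>n. (q - p) * e n) \<longlonglongrightarrow> 0"
      using tendsto_mult[OF tendsto_const[of "q - p"] e] by simp
    show "\<forall>\<^sub>F n in sequentially. norm (T n) \<le> (q - p) * e n"
    proof (intro always_eventually allI)
      fix n
      define A where "A = (\<lambda>a. \<integral>u. M u * complex_of_real (overlap ((u - a) / l n)) \<partial>lborel)"
      let ?h = "\<lambda>a u. complex_of_real (indicator {p..q} a) * (M u * complex_of_real (overlap ((u - a) / l n)))"
      have int: "integrable (lborel \<Otimes>\<^sub>M lborel) (\<lambda>(a, u). ?h a u)"
      proof (rule Bochner_Integration.integrable_bound)
        show "integrable (lborel \<Otimes>\<^sub>M lborel) (\<lambda>(a, u). complex_of_real (indicator {p..q} a) * (2 * (indicator {- R..R} u *\<^sub>R M u)))"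
          by (intro integrable_pair_mult integrable_of_real integrable_indicator_Icc integrable_mult_right int_M)
        show "AE x in lborel \<Otimes>\<^sub>M lborel. norm (case x of (a, u) \<Rightarrow> ?h a u)
            \<le> norm (case x of (a, u) \<Rightarrow> complex_of_real (indicator {p..q} a) * (2 * (indicator {- R..R} u *\<^sub>R M u)))"
        proof (intro AE_I2, clarify)
          fix a u
          show "norm (?h a u) \<le> norm (complex_of_real (indicator {p..q} a) * (2 * (indicator {- R..R} u *\<^sub>R M u)))"
          proof (cases "a \<in> {p..q} \<and> \<bar>u - a\<bar> < 2")
            case True
            then have "\<bar>u\<bar> \<le> R" by (auto simp: R_def)
            then show ?thesis
              using True overlap_nonneg[of "(u - a) / l n"] overlap_le[of "(u - a) / l n"]
              by (auto simp: norm_mult abs_le_iff mult.commute[of "cmod (M u)"] intro!: mult_right_mono)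
          next
            case False
            moreover have "overlap ((u - a) / l n) = 0" if "2 \<le> \<bar>u - a\<bar>"
            proof (rule overlap_outside)
              have "\<bar>u - a\<bar> / 1 \<le> \<bar>u - a\<bar> / l n" using l(1,2)[of n] by (intro divide_left_mono) auto
              then show "2 \<le> \<bar>(u - a) / l n\<bar>" using that l(1)[of n] by (simp add: abs_divide)
            qed
            ultimately have "?h a u = 0" by (cases "a \<in> {p..q}") auto
            then show ?thesis by (simp only: norm_zero norm_ge_zero)
          qed
        qed
      qed measurable
      have "l n * T n = (\<integral>u. (\<integral>a. ?h a u \<partial>lborel) \<partial>lborel)"
      proof -
        have "(\<integral>a. ?h a u \<partial>lborel) = l n * (M u * complex_of_real (V n u))" for u
        proof -
          have "(\<integral>a. ?h a u \<partial>lborel) = (\<integral>a. M u * complex_of_real (indicator {p..q} a * overlap ((u - a) / l n)) \<partial>lborel)"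
            by (intro Bochner_Integration.integral_cong) auto
          also have "\<dots> = M u * complex_of_real (\<integral>a. indicator {p..q} a * overlap ((u - a) / l n) \<partial>lborel)"
            by (simp only: integral_mult_right_zero integral_complex_of_real)
          also have "(\<integral>a. indicator {p..q} a * overlap ((u - a) / l n) \<partial>lborel)
            = \<bar>- l n\<bar> *\<^sub>R (\<integral>v. indicator {p..q} (u + - l n * v) * overlap ((u - (u + - l n * v)) / l n) \<partial>lborel)"
            using l(1)[of n] by (intro lborel_integral_real_affine) auto
          also have "\<dots> = l n * V n u"
            using l(1)[of n] by (simp add: V_def)
          finally show ?thesis by simp
        qed
        then show ?thesis unfolding T_def by simp
      qed
      also have "\<dots> = (\<integral>a. (\<integral>u. ?h a u \<partial>lborel) \<partial>lborel)"
        by (rule lborel_pair.Fubini_integral[OF int])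
      also have "\<dots> = (\<integral>a. complex_of_real (indicator {p..q} a) * A a \<partial>lborel)"
        by (simp add: A_def)
      finally have eq: "l n * T n = (\<integral>a. complex_of_real (indicator {p..q} a) * A a \<partial>lborel)" .
      have "norm (\<integral>a. complex_of_real (indicator {p..q} a) * A a \<partial>lborel) \<le> (\<integral>a. indicator {p..q} a * (l n * e n) \<partial>lborel)"
      proof (rule Bochner_Integration.integral_norm_bound_integral)
        show "integrable lborel (\<lambda>a. complex_of_real (indicator {p..q} a) * A a)"
          using lborel_pair.integrable_fst[OF int] by (simp add: A_def)
        show "integrable lborel (\<lambda>a. indicator {p..q} a * (l n * e n))"
          by (intro integrable_mult_left integrable_indicator_Icc)
        show "norm (complex_of_real (indicator {p..q} a) * A a) \<le> indicator {p..q} a * (l n * e n)" for a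
          using small[where n=n and a=a] by (simp add: norm_mult A_def indicator_def)
      qed
      also have "\<dots> = l n * ((q - p) * e n)"
        using pq by simp
      finally have "l n * norm (T n) \<le> l n * ((q - p) * e n)"
        unfolding eq[symmetric] using l(1)[of n] by (simp add: norm_mult)
      then show "norm (T n) \<le> (q - p) * e n"
        using l(1)[of n] by simp
    qed
  qed
  ultimately have "(\<integral>u. M u * complex_of_real (indicator {p..q} u * m) \<partial>lborel) = 0"
    by (rule LIMSEQ_unique)
  also have "(\<integral>u. M u * complex_of_real (indicator {p..q} u * m) \<partial>lborel)
      = (\<integral>u. complex_of_real m * (indicator {p..q} u *\<^sub>R M u) \<partial>lborel)"
    by (intro Bochner_Integration.integral_cong) (auto simp: scaleR_conv_of_real)
  finally have "complex_of_real m * (\<integral>u. indicator {p..q} u *\<^sub>R M u \<partial>lborel) = 0"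
    by (simp only: integral_mult_right_zero)
  then show ?thesis
    using overlap_integral_pos by (simp add: m_def)
qed

text \<open>
  As the scale tends to infinity, the weight tends to the constant \<open>overlap 0\<close>, but \<open>M\<close> need not be
  integrable. Integrating the estimate over \<open>t\<close> against a de la Vallee-Poussin kernel localises: it
  multiplies \<open>M\<close> by a trapezoid around \<open>a\<close>. Trapezoids with steeper and steeper flanks decrease
  to the indicator of \<open>[p, q]\<close>.
\<close>

lemma interval_integral_zero_if_small_at_coarse_scales:
  fixes M :: "real \<Rightarrow> complex" and l e :: "nat \<Rightarrow> real"
  assumes [measurable]: "M \<in> borel_measurable borel"
    and int_M: "\<And>R. integrable lborel (\<lambda>u. indicator {- R..R} u *\<^sub>R M u)"
    and l: "\<And>n. 0 < l n" "filterlim l at_top sequentially" and e: "e \<longlonglongrightarrow> 0"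
    and small: "\<And>n a t. cmod (\<integral>u. M u * (cis (2 * pi * t * (u - a)) * complex_of_real (overlap ((u - a) / l n))) \<partial>lborel) \<le> e n"
    and pq: "p \<le> q"
  shows "(\<integral>u. indicator {p..q} u *\<^sub>R M u \<partial>lborel) = 0"
proof -
  define a where "a = (p + q) / 2"
  define r where "r = (q - p) / 2"
  have r: "0 \<le> r" using pq by (simp add: r_def)
  have trap_zero: "(\<integral>u. M u * complex_of_real (trapezoid r R (u - a)) \<partial>lborel) = 0" if R: "r < R" for R
  proof -
    define Q where "Q = \<bar>a\<bar> + R"
    define T where "T = (\<lambda>n. \<integral>u. M u * complex_of_real (overlap ((u - a) / l n) * trapezoid r R (u - a)) \<partial>lborel)"
    have supp: "trapezoid r R (u - a) = 0" if "Q < \<bar>u\<bar>" for u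
      using that R by (intro trapezoid_outside) (auto simp: Q_def)
    have "T \<longlonglongrightarrow> (\<integral>u. M u * complex_of_real (overlap 0 * trapezoid r R (u - a)) \<partial>lborel)"
      unfolding T_def
    proof (rule integral_dominated_convergence[where w="\<lambda>u. 2 * cmod (indicator {- Q..Q} u *\<^sub>R M u)"])
      show "integrable lborel (\<lambda>u. 2 * cmod (indicator {- Q..Q} u *\<^sub>R M u))"
        by (intro integrable_mult_right integrable_norm int_M)
      show "AE u in lborel. cmod (M u * complex_of_real (overlap ((u - a) / l n) * trapezoid r R (u - a))) \<le> 2 * cmod (indicator {- Q..Q} u *\<^sub>R M u)" for n
      proof (rule AE_I2)
        fix u
        have "\<bar>overlap ((u - a) / l n) * trapezoid r R (u - a)\<bar> \<le> 2 * 1"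
          unfolding abs_mult using overlap_nonneg overlap_le trapezoid_bounds by (intro mult_mono) auto
        then show "cmod (M u * complex_of_real (overlap ((u - a) / l n) * trapezoid r R (u - a))) \<le> 2 * cmod (indicator {- Q..Q} u *\<^sub>R M u)"
          using supp[of u]
          by (cases "\<bar>u\<bar> \<le> Q") (auto simp: norm_mult abs_le_iff mult.commute[of "cmod (M u)"] simp del: of_real_mult abs_mult intro!: mult_right_mono)
      qed
      show "AE u in lborel. (\<lambda>n. M u * complex_of_real (overlap ((u - a) / l n) * trapezoid r R (u - a)))
          \<longlonglongrightarrow> M u * complex_of_real (overlap 0 * trapezoid r R (u - a))"
      proof (rule AE_I2)
        fix u
        have "(\<lambda>n. (u - a) / l n) \<longlonglongrightarrow> 0"
          by (rule tendsto_divide_0[OF tendsto_const filterlim_at_top_imp_at_infinity[OF l(2)]])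
        then have "(\<lambda>n. overlap ((u - a) / l n)) \<longlonglongrightarrow> overlap 0"
          by (intro continuous_on_tendsto_compose[OF continuous_overlap]) auto
        then show "(\<lambda>n. M u * complex_of_real (overlap ((u - a) / l n) * trapezoid r R (u - a)))
          \<longlonglongrightarrow> M u * complex_of_real (overlap 0 * trapezoid r R (u - a))"
          by (intro tendsto_mult tendsto_of_real tendsto_const)
      qed
    qed measurable
    moreover have "T \<longlonglongrightarrow> 0"
    proof (rule Lim_null_comparison)
      let ?w = "vallee_poussin r R"
      let ?I = "\<integral>t. \<bar>?w t\<bar> \<partial>lborel"
      show "(\<lambda>n. ?I * e n) \<longlonglongrightarrow> 0"
        using tendsto_mult[OF tendsto_const[of ?I] e] by simp
      show "\<forall>\<^sub>F n in sequentially. norm (T n) \<le> ?I * e n"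
      proof (intro always_eventually allI)
        fix n
        define A where "A = (\<lambda>t. \<integral>u. M u * (cis (2 * pi * t * (u - a)) * complex_of_real (overlap ((u - a) / l n))) \<partial>lborel)"
        define Q' where "Q' = \<bar>a\<bar> + 2 * l n"
        let ?h = "\<lambda>t u. complex_of_real (?w t) * (M u * (cis (2 * pi * t * (u - a)) * complex_of_real (overlap ((u - a) / l n))))"
        have int: "integrable (lborel \<Otimes>\<^sub>M lborel) (\<lambda>(t, u). ?h t u)"
        proof (rule Bochner_Integration.integrable_bound)
          show "integrable (lborel \<Otimes>\<^sub>M lborel) (\<lambda>(t, u). complex_of_real (?w t) * (2 * (indicator {- Q'..Q'} u *\<^sub>R M u)))"
            by (intro integrable_pair_mult integrable_of_real integrable_vallee_poussin r R integrable_mult_right int_M)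
          show "AE x in lborel \<Otimes>\<^sub>M lborel. norm (case x of (t, u) \<Rightarrow> ?h t u)
              \<le> norm (case x of (t, u) \<Rightarrow> complex_of_real (?w t) * (2 * (indicator {- Q'..Q'} u *\<^sub>R M u)))"
          proof (intro AE_I2, clarify)
            fix t u
            show "norm (?h t u) \<le> norm (complex_of_real (?w t) * (2 * (indicator {- Q'..Q'} u *\<^sub>R M u)))"
            proof (cases "\<bar>u\<bar> \<le> Q'")
              case True
              then show ?thesis
                using overlap_nonneg[of "(u - a) / l n"] overlap_le[of "(u - a) / l n"]
                by (auto simp: norm_mult abs_le_iff mult.commute[of "cmod (M u)"] intro!: mult_left_mono mult_right_mono)
            next
              case False
              then have "overlap ((u - a) / l n) = 0"
                using l(1)[of n] by (intro overlap_outside) (auto simp: Q'_def abs_divide pos_le_divide_eq)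
              then show ?thesis by simp
            qed
          qed
        qed measurable
        have "T n = (\<integral>u. (\<integral>t. ?h t u \<partial>lborel) \<partial>lborel)"
          unfolding T_def
        proof (rule Bochner_Integration.integral_cong[OF refl])
          fix u
          have "(\<integral>t. ?h t u \<partial>lborel) = (\<integral>t. M u * complex_of_real (overlap ((u - a) / l n)) * (complex_of_real (?w t) * cis (2 * pi * (u - a) * t)) \<partial>lborel)"
            by (intro Bochner_Integration.integral_cong) (auto simp: mult_ac)
          then show "M u * complex_of_real (overlap ((u - a) / l n) * trapezoid r R (u - a)) = (\<integral>t. ?h t u \<partial>lborel)"
            by (simp add: integral_vallee_poussin_exp[OF r R])
        qed
        also have "\<dots> = (\<integral>t. (\<integral>u. ?h t u \<partial>lborel) \<partial>lborel)"
          by (rule lborel_pair.Fubini_integral[OF int])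
        also have "\<dots> = (\<integral>t. complex_of_real (?w t) * A t \<partial>lborel)"
          by (simp add: A_def)
        finally have eq: "T n = (\<integral>t. complex_of_real (?w t) * A t \<partial>lborel)" .
        have "norm (\<integral>t. complex_of_real (?w t) * A t \<partial>lborel) \<le> (\<integral>t. \<bar>?w t\<bar> * e n \<partial>lborel)"
        proof (rule Bochner_Integration.integral_norm_bound_integral)
          show "integrable lborel (\<lambda>t. complex_of_real (?w t) * A t)"
            using lborel_pair.integrable_fst[OF int] by (simp add: A_def)
          show "integrable lborel (\<lambda>t. \<bar>?w t\<bar> * e n)"
            by (intro integrable_mult_left integrable_abs integrable_vallee_poussin r R)
          show "norm (complex_of_real (?w t) * A t) \<le> \<bar>?w t\<bar> * e n" for t
            using small[where n=n and a=a and t=t] by (simp add: norm_mult A_def mult_left_mono)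
        qed
        then show "norm (T n) \<le> ?I * e n" unfolding eq by simp
      qed
    qed
    ultimately have "(\<integral>u. M u * complex_of_real (overlap 0 * trapezoid r R (u - a)) \<partial>lborel) = 0"
      by (rule LIMSEQ_unique)
    also have "(\<integral>u. M u * complex_of_real (overlap 0 * trapezoid r R (u - a)) \<partial>lborel)
        = (\<integral>u. complex_of_real (overlap 0) * (M u * complex_of_real (trapezoid r R (u - a))) \<partial>lborel)"
      by (intro Bochner_Integration.integral_cong) auto
    finally show ?thesis
      using overlap_near_zero[of 0] by simp
  qed
  have "(\<lambda>n. \<integral>u. M u * complex_of_real (trapezoid r (r + 1 / real (Suc n)) (u - a)) \<partial>lborel)
      \<longlonglongrightarrow> (\<integral>u. indicator {p..q} u *\<^sub>R M u \<partial>lborel)"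
  proof (rule integral_dominated_convergence[where w="\<lambda>u. cmod (indicator {- (\<bar>a\<bar> + r + 1)..\<bar>a\<bar> + r + 1} u *\<^sub>R M u)"])
    show "integrable lborel (\<lambda>u. cmod (indicator {- (\<bar>a\<bar> + r + 1)..\<bar>a\<bar> + r + 1} u *\<^sub>R M u))"
      by (intro integrable_norm int_M)
    show "AE u in lborel. norm (M u * complex_of_real (trapezoid r (r + 1 / real (Suc n)) (u - a)))
        \<le> cmod (indicator {- (\<bar>a\<bar> + r + 1)..\<bar>a\<bar> + r + 1} u *\<^sub>R M u)" for n
    proof (rule AE_I2)
      fix u
      show "norm (M u * complex_of_real (trapezoid r (r + 1 / real (Suc n)) (u - a)))
        \<le> cmod (indicator {- (\<bar>a\<bar> + r + 1)..\<bar>a\<bar> + r + 1} u *\<^sub>R M u)"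
      proof (cases "\<bar>u\<bar> \<le> \<bar>a\<bar> + r + 1")
        case True
        then show ?thesis
          using trapezoid_bounds[of r "r + 1 / real (Suc n)" "u - a"]
          by (auto simp: norm_mult abs_le_iff intro!: mult_left_le)
      next
        case False
        have "1 / real (Suc n) \<le> 1" by simp
        then have "trapezoid r (r + 1 / real (Suc n)) (u - a) = 0"
          using False by (intro trapezoid_outside) (simp, linarith)
        then show ?thesis by simp
      qed
    qed
    show "AE u in lborel. (\<lambda>n. M u * complex_of_real (trapezoid r (r + 1 / real (Suc n)) (u - a)))
        \<longlonglongrightarrow> indicator {p..q} u *\<^sub>R M u"
    proof (rule AE_I2)
      fix u
      have iff: "u \<in> {p..q} \<longleftrightarrow> \<bar>u - a\<bar> \<le> r"
        by (auto simp: a_def r_def abs_le_iff field_simps)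
      have "\<forall>\<^sub>F n in sequentially. trapezoid r (r + 1 / real (Suc n)) (u - a) = indicator {p..q} u"
      proof (cases "\<bar>u - a\<bar> \<le> r")
        case True
        then show ?thesis using iff by (simp add: trapezoid_inside)
      next
        case False
        then have "\<forall>\<^sub>F n in sequentially. 1 / real (Suc n) < \<bar>u - a\<bar> - r"
          by (intro order_tendstoD(2)[OF LIMSEQ_Suc[OF lim_1_over_n]]) auto
        then show ?thesis
          using False iff by (auto elim!: eventually_mono intro!: trapezoid_outside)
      qed
      then have "(\<lambda>n. trapezoid r (r + 1 / real (Suc n)) (u - a)) \<longlonglongrightarrow> indicator {p..q} u"
        by (rule tendsto_eventually)
      then have "(\<lambda>n. M u * complex_of_real (trapezoid r (r + 1 / real (Suc n)) (u - a))) \<longlonglongrightarrow> M u * complex_of_real (indicator {p..q} u)"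
        by (intro tendsto_mult tendsto_const tendsto_of_real)
      then show "(\<lambda>n. M u * complex_of_real (trapezoid r (r + 1 / real (Suc n)) (u - a))) \<longlonglongrightarrow> indicator {p..q} u *\<^sub>R M u"
        by (simp add: scaleR_conv_of_real mult.commute)
    qed
  qed measurable
  moreover have "(\<integral>u. M u * complex_of_real (trapezoid r (r + 1 / real (Suc n)) (u - a)) \<partial>lborel) = 0" for n
    by (rule trap_zero) simp
  ultimately show ?thesis
    by (simp only: LIMSEQ_const_iff)
qed

section \<open>Representatives and the theorem\<close>

lemma locally_integrable_borel_measurable:
  assumes "locally_integrable M"
  shows "M \<in> borel_measurable lebesgue"
proof (rule borel_measurable_LIMSEQ_metric)
  show "(\<lambda>u. indicator {- real n..real n} u *\<^sub>R M u) \<in> borel_measurable lebesgue" for n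
    using assms unfolding locally_integrable_def set_integrable_def
    by (intro borel_measurable_integrable) auto
  show "(\<lambda>n. indicator {- real n..real n} u *\<^sub>R M u) \<longlonglongrightarrow> M u" for u
  proof (rule tendsto_eventually)
    obtain N :: nat where "\<bar>u\<bar> \<le> real N" using real_arch_simple by blast
    then have "indicator {- real n..real n} u *\<^sub>R M u = M u" if "N \<le> n" for n
      using that by (auto simp: indicator_def)
    then show "\<forall>\<^sub>F n in sequentially. indicator {- real n..real n} u *\<^sub>R M u = M u"
      by (auto simp: eventually_sequentially)
  qed
qed

lemma lebesgue_measurable_ex_borel:
  fixes M :: "real \<Rightarrow> complex"
  assumes [measurable]: "M \<in> borel_measurable lebesgue"
  shows "\<exists>M'\<in>borel_measurable borel. AE u in lebesgue. M u = M' u"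
proof -
  have "(\<lambda>u. Re (M u)) \<in> borel_measurable lebesgue" "(\<lambda>u. Im (M u)) \<in> borel_measurable lebesgue"
    by measurable
  then obtain f g where fg: "f \<in> borel_measurable lborel" "AE u in lborel. Re (M u) = f u"
      "g \<in> borel_measurable lborel" "AE u in lborel. Im (M u) = g u"
    using completion_ex_borel_measurable_real[of "\<lambda>u. Re (M u)" lborel]
      completion_ex_borel_measurable_real[of "\<lambda>u. Im (M u)" lborel] by auto
  then have [measurable]: "f \<in> borel_measurable borel" "g \<in> borel_measurable borel"
    by simp_all
  have meas: "(\<lambda>u. complex_of_real (f u) + \<i> * complex_of_real (g u)) \<in> borel_measurable borel"
    by measurable
  have "AE u in lborel. M u = complex_of_real (f u) + \<i> * complex_of_real (g u)"
    using fg(2,4) by eventually_elim (simp add: complex_eq_iff)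
  then show ?thesis by (intro bexI[OF AE_completion meas])
qed

lemma null_multiplier:
  assumes \<Phi>: "young_function \<Phi>3" and M: "AE u in lebesgue. M u = 0"
  shows "M \<in> multiplier_space \<Phi>1 \<Phi>2 \<Phi>3"
proof -
  have meas: "M \<in> borel_measurable lebesgue"
  proof (rule borel_measurable_AE)
    show "(\<lambda>_. 0) \<in> borel_measurable lebesgue" by simp
    show "AE u in lebesgue. 0 = M u" using M by eventually_elim simp
  qed
  have "locally_integrable M"
    unfolding locally_integrable_def set_integrable_def
  proof (intro allI impI)
    fix K :: "real set" assume "compact K"
    then have "K \<in> sets lebesgue" by (metis borel_compact sets_completionI_sets sets_lborel)
    show "integrable lebesgue (\<lambda>u. indicator K u *\<^sub>R M u)"
    proof (rule integrable_cong_AE_imp[of _ "\<lambda>_. 0"])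
      show "(\<lambda>u. indicator K u *\<^sub>R M u) \<in> borel_measurable lebesgue"
        using meas \<open>K \<in> sets lebesgue\<close> by measurable
      show "AE u in lebesgue. 0 = indicator K u *\<^sub>R M u"
        using M by eventually_elim simp
    qed simp
  qed
  moreover have "luxemburg_norm \<Phi>3 (bilinear_multiplier M f g) = 0" for f g
    unfolding bilinear_multiplier_cong_AE[OF M]
    by (rule luxemburg_norm_zero[OF \<Phi>]) (simp add: bilinear_multiplier_def)
  ultimately show ?thesis
    unfolding multiplier_space_def by (auto intro: exI[of _ 1])
qed

text \<open>
  Lebesgue measurability is not inherited by \<open>M (\<xi> - \<eta>)\<close> with respect to the product of Borel measures,
  hence the passage to a Borel representative before Fubini's theorem is used.
\<close>

lemma multiplier_ex_borel:
  assumes M: "M \<in> multiplier_space \<Phi>1 \<Phi>2 \<Phi>3"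
  obtains M' where "M' \<in> borel_measurable borel" "AE u in lebesgue. M u = M' u"
    "M' \<in> multiplier_space \<Phi>1 \<Phi>2 \<Phi>3"
    "\<And>R. integrable lborel (\<lambda>u. indicator {- R..R} u *\<^sub>R M' u)"
proof -
  have loc: "locally_integrable M" using M by (simp add: multiplier_space_def)
  obtain M' where M': "M' \<in> borel_measurable borel" and ae: "AE u in lebesgue. M u = M' u"
    using lebesgue_measurable_ex_borel[OF locally_integrable_borel_measurable[OF loc]] by blast
  have int: "set_integrable lebesgue K M'" if K: "compact K" for K
    unfolding set_integrable_def
  proof (rule integrable_cong_AE_imp)
    show "integrable lebesgue (\<lambda>u. indicator K u *\<^sub>R M u)"
      using loc K by (simp add: locally_integrable_def set_integrable_def)
    show "(\<lambda>u. indicator K u *\<^sub>R M' u) \<in> borel_measurable lebesgue"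
      using M' borel_compact[OF K] by (intro measurable_completion) simp
    show "AE u in lebesgue. indicator K u *\<^sub>R M u = indicator K u *\<^sub>R M' u"
      using ae by eventually_elim simp
  qed
  show ?thesis
  proof (rule that[OF M' ae])
    show "M' \<in> multiplier_space \<Phi>1 \<Phi>2 \<Phi>3"
    proof -
      have "bilinear_multiplier M f g = bilinear_multiplier M' f g" for f g
        by (rule bilinear_multiplier_cong_AE[OF ae])
      then show ?thesis
        using M int by (simp add: multiplier_space_def locally_integrable_def)
    qed
    show "integrable lborel (\<lambda>u. indicator {- R..R} u *\<^sub>R M' u)" for R
      using int[of "{- R..R}"] M' unfolding set_integrable_def
      by (simp add: integrable_completion)
  qed
qed

lemma Liminf_eq_0_imp_frequently_small:
  fixes f :: "'a \<Rightarrow> ennreal"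
  assumes "Liminf F f = 0" "0 < \<epsilon>"
  shows "\<exists>\<^sub>F x in F. f x < \<epsilon>"
proof (rule ccontr)
  assume "\<not> (\<exists>\<^sub>F x in F. f x < \<epsilon>)"
  then have "\<epsilon> \<le> Liminf F f"
    by (intro Liminf_bounded) (simp add: frequently_def not_less)
  then show False using assms by simp
qed

theorem corollary5p6:
  fixes \<Phi>1 \<Phi>2 \<Phi>3 :: "real \<Rightarrow> ennreal" and \<alpha> \<beta> :: ennreal
  assumes "young_function \<Phi>1" and "young_function \<Phi>2" and "young_function \<Phi>3"
    and "\<alpha> = Liminf (at_right 0)
               (\<lambda>l. dilation_norm \<Phi>1 l * dilation_norm \<Phi>2 l * dilation_norm \<Phi>3 (1 / l))"
    and "\<beta> = Liminf at_top
               (\<lambda>l. ennreal l * dilation_norm \<Phi>1 l * dilation_norm \<Phi>2 l * dilation_norm \<Phi>3 (1 / l))"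
    and "\<alpha> = 0 \<or> \<beta> = 0"
  shows "multiplier_space \<Phi>1 \<Phi>2 \<Phi>3 = {M. AE x in lebesgue. M x = 0}"
proof (intro set_eqI iffI)
  fix M :: "real \<Rightarrow> complex" assume "M \<in> {M. AE x in lebesgue. M x = 0}"
  then show "M \<in> multiplier_space \<Phi>1 \<Phi>2 \<Phi>3"
    using null_multiplier[OF assms(3)] by simp
next
  fix M assume "M \<in> multiplier_space \<Phi>1 \<Phi>2 \<Phi>3"
  then obtain N where N: "N \<in> borel_measurable borel" "AE u in lebesgue. M u = N u"
      "N \<in> multiplier_space \<Phi>1 \<Phi>2 \<Phi>3"
    and int_N: "\<And>R. integrable lborel (\<lambda>u. indicator {- R..R} u *\<^sub>R N u)"
    by (rule multiplier_ex_borel) blast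
  let ?\<theta> = "\<lambda>l. dilation_norm \<Phi>1 l * dilation_norm \<Phi>2 l * dilation_norm \<Phi>3 (1 / l)"
  let ?A = "\<lambda>l a t. \<integral>u. N u * (cis (2 * pi * t * (u - a)) * complex_of_real (overlap ((u - a) / l))) \<partial>lborel"
  obtain K :: real where K0: "0 \<le> K" "\<And>l a t. 0 < l \<Longrightarrow> ennreal (cmod (?A l a t))
      \<le> ennreal K * (ennreal l * dilation_norm \<Phi>1 l * dilation_norm \<Phi>2 l * dilation_norm \<Phi>3 (1 / l))"
    by (rule multiplier_test_estimate[OF assms(1-3) N(3,1) int_N]) blast
  then have K: "0 \<le> K" "\<And>l a t. 0 < l \<Longrightarrow> ennreal (cmod (?A l a t)) \<le> ennreal K * (ennreal l * ?\<theta> l)"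
    by (simp_all only: mult.assoc)
  define \<epsilon> where "\<epsilon> = (\<lambda>n. 1 / real (Suc n))"
  have \<epsilon>: "0 < \<epsilon> n" "\<epsilon> n \<le> 1" "\<epsilon> \<longlonglongrightarrow> 0" for n
    unfolding \<epsilon>_def using LIMSEQ_Suc[OF lim_1_over_n] by auto
  have K\<epsilon>: "(\<lambda>n. K * \<epsilon> n) \<longlonglongrightarrow> 0"
    using tendsto_mult[OF tendsto_const[of K] \<epsilon>(3)] by simp
  from assms(6) have "(\<integral>u. indicator {p..q} u *\<^sub>R N u \<partial>lborel) = 0" if pq: "p \<le> q" for p q
  proof
    assume "\<alpha> = 0"
    have "\<exists>l. 0 < l \<and> l < \<epsilon> n \<and> ?\<theta> l < ennreal (\<epsilon> n)" for n
    proof -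
      have "\<exists>\<^sub>F l in at_right 0. ?\<theta> l < ennreal (\<epsilon> n)"
        using \<open>\<alpha> = 0\<close> assms(4) \<epsilon>(1)[of n] by (intro Liminf_eq_0_imp_frequently_small) auto
      moreover have "\<forall>\<^sub>F l in at_right 0. l \<in> {0<..<\<epsilon> n}"
        using \<epsilon>(1)[of n] by (intro eventually_at_right_real)
      ultimately have "\<exists>\<^sub>F l in at_right 0. ?\<theta> l < ennreal (\<epsilon> n) \<and> l \<in> {0<..<\<epsilon> n}"
        by (rule frequently_eventually_frequently)
      then show ?thesis by (auto dest: frequently_ex)
    qed
    then obtain l where l: "\<And>n. 0 < l n" "\<And>n. l n < \<epsilon> n" "\<And>n. ?\<theta> (l n) < ennreal (\<epsilon> n)"
      by metis
    show ?thesis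
    proof (rule interval_integral_zero_if_small_at_fine_scales[OF N(1) int_N _ _ _ K\<epsilon> _ pq])
      show "0 < l n" for n by (rule l)
      show "l n \<le> 1" for n using l(2)[of n] \<epsilon>(2)[of n] by simp
      show "l \<longlonglongrightarrow> 0"
        by (rule tendsto_sandwich[OF _ _ tendsto_const \<epsilon>(3)])
           (use l in \<open>auto intro!: always_eventually less_imp_le\<close>)
      fix n a
      have "ennreal (cmod (?A (l n) a 0)) \<le> ennreal K * (ennreal (l n) * ?\<theta> (l n))"
        by (rule K(2)[OF l(1)])
      also have "\<dots> \<le> ennreal K * (ennreal (l n) * ennreal (\<epsilon> n))"
        using less_imp_le[OF l(3)[of n]] by (intro mult_left_mono) auto
      also have "\<dots> = ennreal (l n * (K * \<epsilon> n))"
      proof -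
        have "ennreal K * (ennreal (l n) * ennreal (\<epsilon> n)) = ennreal (K * (l n * \<epsilon> n))"
          using K(1) less_imp_le[OF l(1)[of n]] less_imp_le[OF \<epsilon>(1)[of n]] by (simp add: ennreal_mult)
        then show ?thesis by (simp only: mult.left_commute)
      qed
      finally show "cmod (\<integral>u. N u * complex_of_real (overlap ((u - a) / l n)) \<partial>lborel) \<le> l n * (K * \<epsilon> n)"
        using K(1) l(1)[of n] \<epsilon>(1)[of n] by (simp add: ennreal_le_iff)
    qed
  next
    assume "\<beta> = 0"
    have "\<exists>l. real (Suc n) < l \<and> ennreal l * ?\<theta> l < ennreal (\<epsilon> n)" for n
    proof -
      have "\<exists>\<^sub>F l in at_top. ennreal l * ?\<theta> l < ennreal (\<epsilon> n)"
        using \<open>\<beta> = 0\<close> assms(5) \<epsilon>(1)[of n] by (intro Liminf_eq_0_imp_frequently_small) (auto simp: mult.assoc)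
      then have "\<exists>\<^sub>F l in at_top. ennreal l * ?\<theta> l < ennreal (\<epsilon> n) \<and> real (Suc n) < l"
        using eventually_gt_at_top by (rule frequently_eventually_frequently)
      then show ?thesis by (auto dest: frequently_ex)
    qed
    then obtain l where l: "\<And>n. real (Suc n) < l n" "\<And>n. ennreal (l n) * ?\<theta> (l n) < ennreal (\<epsilon> n)"
      by metis
    have l0: "0 < l n" for n using l(1)[of n] by linarith
    show ?thesis
    proof (rule interval_integral_zero_if_small_at_coarse_scales[OF N(1) int_N _ _ K\<epsilon> _ pq])
      show "0 < l n" for n by (rule l0)
      show "filterlim l at_top sequentially"
      proof (rule filterlim_at_top_mono[OF filterlim_real_sequentially always_eventually], rule allI)
        show "real n \<le> l n" for n using l(1)[of n] by linarith
      qed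
      fix n a t
      have "ennreal (cmod (?A (l n) a t)) \<le> ennreal K * (ennreal (l n) * ?\<theta> (l n))"
        by (rule K(2)[OF l0])
      also have "\<dots> \<le> ennreal K * ennreal (\<epsilon> n)"
        using less_imp_le[OF l(2)[of n]] by (intro mult_left_mono) auto
      also have "\<dots> = ennreal (K * \<epsilon> n)"
        using K(1) less_imp_le[OF \<epsilon>(1)[of n]] by (simp add: ennreal_mult)
      finally show "cmod (?A (l n) a t) \<le> K * \<epsilon> n"
        using K(1) \<epsilon>(1)[of n] by (simp add: ennreal_le_iff)
    qed
  qed
  then have "AE u in lborel. N u = 0"
    by (intro AE_zero_if_interval_integrals_zero int_N)
  then have "AE u in lebesgue. N u = 0" by (rule AE_completion)
  with N(2) have "AE u in lebesgue. M u = 0" by eventually_elim simp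
  then show "M \<in> {M. AE x in lebesgue. M x = 0}" by simp
qed

end
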